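(* A convex polygon $P$ in the plane (a two-dimensional polytope $P\subset\mathbb{R}^2$) has psd rank three if and only if it has at most four vertices.
   Context: $\mathcal{S}_+^k$ denotes the cone of $k\times k$ real symmetric positive semidefinite (psd) matrices. An $\mathcal{S}_+^k$-lift of a polytope $P\subset\mathbb{R}^n$ is a set $\mathcal{S}_+^k\cap L$, with $L$ an affine subspace of the space of real symmetric $k\times k$ matrices, such that $P=\pi(\mathcal{S}_+^k\cap L)$ for some linear map $\pi$ to $\mathbb{R}^n$. The psd rank of $P$ is the smallest positive integer $k$ such that $P$ has an $\mathcal{S}_+^k$-lift. *)

theory Defs
  imports "HOL-Analysis.Analysis" "Jordan_Normal_Form.Matrix"
begin

definition sym_mats :: "nat \<Rightarrow> real mat set" where
  "sym_mats k = {A \<in> carrier_mat k k. transpose_mat A = A}"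

definition psd_cone :: "nat \<Rightarrow> real mat set" where
  "psd_cone k = {A \<in> sym_mats k. \<forall>v \<in> carrier_vec k. scalar_prod v (A *\<^sub>v v) \<ge> 0}"

text \<open>The matrix type comprises matrices of all sizes and so is not a
  \<^class>\<open>real_vector\<close>; affine subspaces of, and linear maps on, the space of symmetric
  matrices of size \<open>k\<close> are therefore spelled out. As for \<^const>\<open>affine\<close>, the empty set
  counts as an affine subspace.\<close>

definition affine_sym :: "nat \<Rightarrow> real mat set \<Rightarrow> bool" where
  "affine_sym k L \<longleftrightarrow> L \<subseteq> sym_mats k \<and>
     (\<forall>X \<in> L. \<forall>Y \<in> L. \<forall>u v. u + v = 1 \<longrightarrow> u \<cdot>\<^sub>m X + v \<cdot>\<^sub>m Y \<in> L)"

definition linear_sym :: "nat \<Rightarrow> (real mat \<Rightarrow> 'a::real_vector) \<Rightarrow> bool" where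
  "linear_sym k f \<longleftrightarrow>
     (\<forall>X \<in> sym_mats k. \<forall>Y \<in> sym_mats k. f (X + Y) = f X + f Y) \<and>
     (\<forall>c. \<forall>X \<in> sym_mats k. f (c \<cdot>\<^sub>m X) = c *\<^sub>R f X)"

definition has_psd_lift :: "nat \<Rightarrow> (real ^ 'n) set \<Rightarrow> bool" where
  "has_psd_lift k P \<longleftrightarrow>
     (\<exists>L \<pi>. affine_sym k L \<and> linear_sym k \<pi> \<and> P = \<pi> ` (psd_cone k \<inter> L))"

definition psd_rank :: "(real ^ 'n) set \<Rightarrow> nat" where
  "psd_rank P = (LEAST k. k > 0 \<and> has_psd_lift k P)"

end

theory Submission
  imports Defs
begin

text \<open>Let a lift of \<open>P\<close> of size at most three be given. The fibre of a vertex lies in a face of the lift two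
  levels below the top, so it contains a matrix of rank one, \<open>x\<^sub>v x\<^sub>v\<^sup>T\<close> with \<open>x\<^sub>v \<in> \<real>\<^sup>3\<close>. Perturbing
  inside the affine span of four such matrices shows that the slack of an edge at a vertex \<open>v\<close> is, up to a factor
  depending on the edge only, the square of the linear form in \<open>x\<^sub>v\<close> that vanishes on the endpoints
  of the edge. Hence the slack matrix and its entrywise square root both have rank three. Five
  vertices, consecutive along four edges, would turn this into \<open>A + B + C = 0\<close> and
  \<open>A\<^sup>2 - B\<^sup>2 + C\<^sup>2 = 0\<close> with \<open>A C \<noteq> 0\<close>. Conversely, a triangle has the diagonal lift, and a quadrilateral with
  \<open>p\<^sub>4 = A p\<^sub>1 - B p\<^sub>2 + C p\<^sub>3\<close> is lifted by sending three scaled diagonal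
  unit matrices and the all-ones matrix to its vertices.\<close>

section \<open>Positive semidefinite lifts\<close>

lemma quadratic_form_mat:
  fixes A :: "real mat"
  assumes "A \<in> carrier_mat k k" "v \<in> carrier_vec k"
  shows "scalar_prod v (A *\<^sub>v v) = (\<Sum>i<k. \<Sum>j<k. vec_index v i * A $$ (i, j) * vec_index v j)"
  using assms
  by (auto simp: scalar_prod_def sum_distrib_left mult.assoc atLeast0LessThan intro!: sum.cong)

text \<open>Test vectors become arbitrary functions on the indices, so that later proofs can name
  them by coordinates without carrier conditions.\<close>

lemma psd_cone_iff:
  "X \<in> psd_cone k \<longleftrightarrow> X \<in> sym_mats k \<and>
     (\<forall>v. 0 \<le> (\<Sum>i<k. \<Sum>j<k. v i * X $$ (i, j) * v j))"
proof (intro iffI conjI allI)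
  fix v :: "nat \<Rightarrow> real"
  assume X: "X \<in> psd_cone k"
  then have "0 \<le> scalar_prod (Matrix.vec k v) (X *\<^sub>v Matrix.vec k v)"
    by (auto simp: psd_cone_def)
  also have "\<dots> = (\<Sum>i<k. \<Sum>j<k. v i * X $$ (i, j) * v j)"
    using X by (subst quadratic_form_mat[of _ k]) (auto simp: psd_cone_def sym_mats_def intro!: sum.cong)
  finally show "0 \<le> (\<Sum>i<k. \<Sum>j<k. v i * X $$ (i, j) * v j)" .
next
  assume X: "X \<in> sym_mats k \<and> (\<forall>v. 0 \<le> (\<Sum>i<k. \<Sum>j<k. v i * X $$ (i, j) * v j))"
  show "X \<in> psd_cone k"
    unfolding psd_cone_def
  proof (intro CollectI conjI ballI)
    fix v :: "real Matrix.vec" assume "v \<in> carrier_vec k"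
    then show "0 \<le> scalar_prod v (X *\<^sub>v v)"
      using X by (subst quadratic_form_mat[of _ k]) (auto simp: sym_mats_def)
  qed (use X in blast)
qed (auto simp: psd_cone_def)

lemma sym_mats_index:
  "X \<in> sym_mats k \<Longrightarrow> i < k \<Longrightarrow> j < k \<Longrightarrow> X $$ (i, j) = X $$ (j, i)"
  by (metis (mono_tags, lifting) carrier_matD index_transpose_mat(1) mem_Collect_eq sym_mats_def)

lemma sym_matsI:
  assumes "X \<in> carrier_mat k k" "\<And>i j. i < k \<Longrightarrow> j < k \<Longrightarrow> X $$ (i, j) = X $$ (j, i)"
  shows "X \<in> sym_mats k"
  using assms by (auto simp: sym_mats_def)

lemma sym_mats_combination:
  assumes "X \<in> sym_mats k" "Y \<in> sym_mats k"
  shows "u \<cdot>\<^sub>m X + v \<cdot>\<^sub>m Y \<in> sym_mats k"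
  using assms sym_mats_index[OF assms(1)] sym_mats_index[OF assms(2)]
  by (intro sym_matsI) (auto simp: sym_mats_def)

lemma index_combination:
  fixes X Y :: "real mat"
  assumes "X \<in> sym_mats k" "Y \<in> sym_mats k" "i < k" "j < k"
  shows "(u \<cdot>\<^sub>m X + v \<cdot>\<^sub>m Y) $$ (i, j) = u * X $$ (i, j) + v * Y $$ (i, j)"
  using assms by (auto simp: sym_mats_def)

lemma linear_sym_combination:
  assumes "linear_sym k f" "X \<in> sym_mats k" "Y \<in> sym_mats k"
  shows "f (u \<cdot>\<^sub>m X + v \<cdot>\<^sub>m Y) = u *\<^sub>R f X + v *\<^sub>R f Y"
proof -
  have "u \<cdot>\<^sub>m X \<in> sym_mats k" "v \<cdot>\<^sub>m Y \<in> sym_mats k"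
    using assms sym_mats_index[OF assms(2)] sym_mats_index[OF assms(3)]
    by (auto intro!: sym_matsI simp: sym_mats_def)
  then show ?thesis
    using assms by (simp add: linear_sym_def)
qed

lemma psd_cone_combination:
  assumes "X \<in> psd_cone k" "Y \<in> psd_cone k" "0 \<le> u" "0 \<le> v"
  shows "u \<cdot>\<^sub>m X + v \<cdot>\<^sub>m Y \<in> psd_cone k"
proof -
  have X: "X \<in> sym_mats k" and Y: "Y \<in> sym_mats k"
    using assms by (auto simp: psd_cone_def)
  have "(\<Sum>i<k. \<Sum>j<k. z i * (u \<cdot>\<^sub>m X + v \<cdot>\<^sub>m Y) $$ (i, j) * z j)
      = u * (\<Sum>i<k. \<Sum>j<k. z i * X $$ (i, j) * z j) + v * (\<Sum>i<k. \<Sum>j<k. z i * Y $$ (i, j) * z j)" for z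
    unfolding sum_distrib_left sum.distrib[symmetric]
    by (intro sum.cong refl) (subst index_combination[OF X Y], auto simp: algebra_simps)
  then show ?thesis
    using assms sym_mats_combination[OF X Y] by (auto simp: psd_cone_iff)
qed

text \<open>The image of a lift is convex, so by Krein-Milman it contains \<open>P\<close> as soon
  as it contains the extreme points. A lift can thus be checked on the vertices and by one
  inclusion.\<close>

lemma has_psd_liftI:
  fixes P :: "(real ^ 'n) set"
  assumes "polytope P" "affine_sym k L" "linear_sym k f"
    and sub: "\<And>X. X \<in> psd_cone k \<Longrightarrow> X \<in> L \<Longrightarrow> f X \<in> P"
    and ext: "\<And>p. p extreme_point_of P \<Longrightarrow> \<exists>X \<in> psd_cone k \<inter> L. f X = p"
  shows "has_psd_lift k P"
proof -
  have "convex (f ` (psd_cone k \<inter> L))"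
    unfolding convex_def
  proof (intro ballI allI impI)
    fix p q and u v :: real
    assume "p \<in> f ` (psd_cone k \<inter> L)" "q \<in> f ` (psd_cone k \<inter> L)" and uv: "0 \<le> u" "0 \<le> v" "u + v = 1"
    then obtain X Y where X: "X \<in> psd_cone k" "X \<in> L" "p = f X" and Y: "Y \<in> psd_cone k" "Y \<in> L" "q = f Y"
      by auto
    have "f (u \<cdot>\<^sub>m X + v \<cdot>\<^sub>m Y) = u *\<^sub>R p + v *\<^sub>R q"
      using X Y assms(3) by (simp add: linear_sym_combination psd_cone_def)
    moreover have "u \<cdot>\<^sub>m X + v \<cdot>\<^sub>m Y \<in> psd_cone k \<inter> L"
      using psd_cone_combination X Y uv assms(2) by (auto simp: affine_sym_def)
    ultimately show "u *\<^sub>R p + v *\<^sub>R q \<in> f ` (psd_cone k \<inter> L)"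
      by (metis imageI)
  qed
  moreover have "{p. p extreme_point_of P} \<subseteq> f ` (psd_cone k \<inter> L)"
    using ext by fastforce
  ultimately have "convex hull {p. p extreme_point_of P} \<subseteq> f ` (psd_cone k \<inter> L)"
    by (simp add: hull_minimal)
  moreover have "P = convex hull {p. p extreme_point_of P}"
    using assms(1) by (metis Krein_Milman_polytope polytope_def)
  ultimately have "P = f ` (psd_cone k \<inter> L)"
    using sub by auto
  then show ?thesis
    using assms unfolding has_psd_lift_def by blast
qed

lemma psd_diagonal_nonneg:
  assumes "X \<in> psd_cone k" "i < k"
  shows "0 \<le> X $$ (i, i)"
proof -
  let ?v = "\<lambda>j. if j = i then 1 else 0 :: real"
  have "0 \<le> (\<Sum>i<k. \<Sum>j<k. ?v i * X $$ (i, j) * ?v j)"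
    using assms(1) unfolding psd_cone_iff by (elim conjE) (erule spec)
  also have "\<dots> = (\<Sum>l<k. if l = i then X $$ (i, i) else 0)"
    using assms by (intro sum.cong refl) (simp add: if_distrib[of "\<lambda>x. _ * x"] sum.delta' cong: if_cong)
  also have "\<dots> = X $$ (i, i)"
    using assms by simp
  finally show ?thesis .
qed

text \<open>Diagonal psd matrices of trace one form a simplex, and their diagonal entries serve as
  the weights of a convex combination of the vertices. This settles triangles and shows that some
  lift always exists.\<close>

lemma polytope_has_psd_lift:
  fixes P :: "(real ^ 'n) set"
  assumes P: "polytope P"
  shows "has_psd_lift (card {v. v extreme_point_of P}) P"
proof -
  let ?E = "{v. v extreme_point_of P}"
  define k where "k = card ?E"
  have fin: "finite ?E"
    using P by (simp add: finite_polyhedron_extreme_points polytope_imp_polyhedron)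
  obtain p where p: "bij_betw p {..<k} ?E"
    unfolding k_def using fin by (metis bij_betw_from_nat_into_finite)
  define L where "L = {X \<in> sym_mats k. (\<forall>i<k. \<forall>j<k. i \<noteq> j \<longrightarrow> X $$ (i, j) = 0) \<and> (\<Sum>i<k. X $$ (i, i)) = 1}"
  define f where "f = (\<lambda>X :: real mat. \<Sum>i<k. X $$ (i, i) *\<^sub>R p i)"
  have "has_psd_lift k P"
  proof (rule has_psd_liftI[OF P, of k L f])
    have "(\<Sum>i<k. (u \<cdot>\<^sub>m X + v \<cdot>\<^sub>m Y) $$ (i, i)) = u * (\<Sum>i<k. X $$ (i, i)) + v * (\<Sum>i<k. Y $$ (i, i))"
      if "X \<in> sym_mats k" "Y \<in> sym_mats k" for X Y :: "real mat" and u v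
      by (simp add: index_combination[OF that] sum.distrib sum_distrib_left)
    then show "affine_sym k L"
      unfolding affine_sym_def L_def by (auto simp: sym_mats_combination index_combination)
    show "linear_sym k f"
      unfolding linear_sym_def f_def
      by (auto simp: sym_mats_def scaleR_add_left sum.distrib scaleR_right.sum)
  next
    fix X assume X: "X \<in> psd_cone k" "X \<in> L"
    have "p ` {..<k} \<subseteq> P"
      using p by (auto simp: bij_betw_def extreme_point_of_def)
    then show "f X \<in> P"
      unfolding f_def using X psd_diagonal_nonneg[OF X(1)] polytope_imp_convex[OF P]
      by (intro convex_sum) (auto simp: L_def)
  next
    fix q assume "q extreme_point_of P"
    then obtain i where i: "i < k" "q = p i"
      using p by (auto simp: bij_betw_def)
    define X where "X = Matrix.mat k k (\<lambda>(r, s). if r = i \<and> s = i then 1 else 0 :: real)"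
    have sym: "X \<in> sym_mats k"
      by (auto simp: X_def intro!: sym_matsI)
    have "(\<Sum>r<k. \<Sum>s<k. v r * X $$ (r, s) * v s) = (v i)\<^sup>2" for v
    proof -
      have "(\<Sum>r<k. \<Sum>s<k. v r * X $$ (r, s) * v s) = (\<Sum>r<k. if r = i then (v i)\<^sup>2 else 0)"
        using i by (intro sum.cong refl) (auto simp: X_def power2_eq_square if_distrib[of "\<lambda>x. x * _"] if_distrib[of "\<lambda>x. _ * x"] cong: if_cong)
      then show ?thesis using i by simp
    qed
    then have "X \<in> psd_cone k"
      using sym by (simp add: psd_cone_iff)
    moreover have "(\<Sum>r<k. X $$ (r, r)) = 1"
      using i by (simp add: X_def)
    then have "X \<in> L"
      using sym by (auto simp: L_def X_def)
    moreover have "f X = (\<Sum>r<k. if r = i then p i else 0)"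
      unfolding f_def by (intro sum.cong refl) (auto simp: X_def)
    then have "f X = q"
      using i by simp
    ultimately show "\<exists>X \<in> psd_cone k \<inter> L. f X = q"
      by blast
  qed
  then show ?thesis
    by (simp add: k_def)
qed

section \<open>Positive semidefinite forms and their kernels\<close>

text \<open>Symmetry is not included and is carried as a separate hypothesis. Matrices of fixed size
  form a real vector space, so the affine and topological theory applies to them.\<close>

definition psd_form :: "real ^ 'n ^ 'n \<Rightarrow> bool" where
  "psd_form X \<longleftrightarrow> (\<forall>u. 0 \<le> inner u (X *v u))"

text \<open>Moving from \<open>u\<close> in the direction \<open>- (X *v u)\<close> would make the
  form negative to first order unless \<open>X *v u\<close> vanishes.\<close>

lemma psd_form_kernel:
  fixes X :: "real ^ 'n ^ 'n"
  assumes X: "Finite_Cartesian_Product.transpose X = X" "psd_form X" and u: "inner u (X *v u) = 0"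
  shows "X *v u = 0"
proof (rule ccontr)
  let ?w = "X *v u"
  assume "?w \<noteq> 0"
  define c d where "c = inner ?w ?w" and "d = inner ?w (X *v ?w)"
  have c: "0 < c" and d: "0 \<le> d"
    using \<open>?w \<noteq> 0\<close> X by (auto simp: c_def d_def psd_form_def)
  \<comment> \<open>\<open>t\<close> is negative and so small that the linear term
    \<open>2 * t * c\<close> outweighs \<open>t\<^sup>2 * d\<close>; the added 1 covers the case
    \<open>d = 0\<close>.\<close>
  define t where "t = - c / (d + 1)"
  have "inner u (X *v ?w) = c"
    using X(1) unfolding c_def by (metis dot_lmul_matrix vector_transpose_matrix)
  then have "inner (u + t *\<^sub>R ?w) (X *v (u + t *\<^sub>R ?w)) = t * (2 * c + t * d)"
    using u by (simp add: c_def d_def matrix_vector_right_distrib matrix_vector_mult_scaleR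
        inner_add_left inner_add_right algebra_simps)
  moreover have "0 \<le> inner (u + t *\<^sub>R ?w) (X *v (u + t *\<^sub>R ?w))"
    using X(2) by (simp add: psd_form_def)
  moreover have "t < 0"
    using c d by (simp add: t_def)
  moreover have "t * d > - c"
  proof -
    have "c * d < c * (d + 1)" using c by simp
    then show ?thesis using d by (simp add: t_def field_simps)
  qed
  then have "2 * c + t * d > 0" using c by linarith
  ultimately show False
    by (smt (verit) mult_neg_pos)
qed

text \<open>On the orthogonal complement of the kernel of \<open>X\<close>, the form of
  \<open>X\<close> has a positive minimum over unit vectors, while that of \<open>Y\<close> is
  bounded. Kernel components contribute to neither form.\<close>

lemma psd_form_dominates:
  fixes X Y :: "real ^ 'n ^ 'n"
  assumes X: "Finite_Cartesian_Product.transpose X = X" "psd_form X"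
    and Y: "Finite_Cartesian_Product.transpose Y = Y"
    and ker: "\<And>u. X *v u = 0 \<Longrightarrow> Y *v u = 0"
  obtains c where "0 < c" "\<And>u. inner u (Y *v u) \<le> c * inner u (X *v u)"
proof -
  \<comment> \<open>The unit sphere of the orthogonal complement of the kernel; it is empty exactly
    when \<open>X = 0\<close>.\<close>
  define S where "S = sphere 0 1 \<inter> (\<Inter>w \<in> {w. X *v w = 0}. {u. inner w u = 0})"
  have "compact S"
    unfolding S_def by (intro compact_Int_closed compact_sphere closed_INT ballI closed_hyperplane)
  obtain m where m: "0 < m" "\<And>u. u \<in> S \<Longrightarrow> m \<le> inner u (X *v u)"
  proof (cases "S = {}")
    case True
    then show ?thesis using that[of 1] by auto
  next
    case False
    have "continuous_on S (\<lambda>u. inner u (X *v u))"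
      by (intro continuous_intros matrix_vector_mult_linear_continuous_on)
    then obtain s where s: "s \<in> S" "\<And>u. u \<in> S \<Longrightarrow> inner s (X *v s) \<le> inner u (X *v u)"
      using continuous_attains_inf[OF \<open>compact S\<close> False] by blast
    have "inner s (X *v s) \<noteq> 0"
    proof
      assume "inner s (X *v s) = 0"
      then have "inner s s = 0"
        using psd_form_kernel[OF X] s(1) by (auto simp: S_def)
      then show False
        using s(1) by (auto simp: S_def)
    qed
    then have "0 < inner s (X *v s)"
      using X(2) by (simp add: psd_form_def less_le)
    then show ?thesis using that s by blast
  qed
  obtain K where K: "0 < K" "\<And>u. norm (Y *v u) \<le> norm u * K"
    using bounded_linear.pos_bounded[OF matrix_vector_mul_bounded_linear[of Y]] by blast
  have dom: "inner z (Y *v z) \<le> K / m * inner z (X *v z)" if z: "\<And>w. X *v w = 0 \<Longrightarrow> inner w z = 0" for z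
  proof (cases "z = 0")
    case False
    have "z /\<^sub>R norm z \<in> S"
      using False z by (auto simp: S_def)
    then have "m \<le> inner z (X *v z) / (norm z)\<^sup>2"
      using m(2)[of "z /\<^sub>R norm z"] by (simp add: matrix_vector_mult_scaleR power2_eq_square divide_inverse algebra_simps)
    then have "m * (norm z)\<^sup>2 \<le> inner z (X *v z)"
      using False by (simp add: field_simps)
    then have "K / m * (m * (norm z)\<^sup>2) \<le> K / m * inner z (X *v z)"
      using K m by (intro mult_left_mono) auto
    moreover have "inner z (Y *v z) \<le> norm z * (norm z * K)"
      using norm_cauchy_schwarz[of z "Y *v z"] K(2)[of z] by (meson mult_left_mono norm_ge_zero order_trans)
    ultimately show ?thesis
      using m(1) by (simp add: power2_eq_square algebra_simps)
  qed auto
  have sub: "subspace {w. X *v w = 0}"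
    by (auto simp: subspace_def matrix_vector_right_distrib matrix_vector_mult_scaleR)
  show thesis
  proof
    show "0 < K / m" using K m by simp
    fix u
    \<comment> \<open>Here \<open>y\<close> is the kernel component. By symmetry the mixed terms
      vanish, so both forms take the same value at \<open>u\<close> as at \<open>z\<close>.\<close>
    obtain y z where yz: "y \<in> span {w. X *v w = 0}" "\<And>w. w \<in> span {w. X *v w = 0} \<Longrightarrow> real_inner_class.orthogonal z w" "u = y + z"
      using orthogonal_subspace_decomp_exists[of "{w. X *v w = 0}" u] by metis
    then have y: "X *v y = 0" "Y *v y = 0" and z: "\<And>w. X *v w = 0 \<Longrightarrow> inner w z = 0"
      using ker by (auto simp: span_eq_iff[THEN iffD2, OF sub] real_inner_class.orthogonal_def inner_commute)
    have "inner y (X *v z) = 0" "inner y (Y *v z) = 0"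
      using y X(1) Y by (metis dot_lmul_matrix inner_zero_left vector_transpose_matrix)+
    then show "inner u (Y *v u) \<le> K / m * inner u (X *v u)"
      using dom[OF z] y by (simp add: yz(3) matrix_vector_right_distrib inner_add_left)
  qed
qed

text \<open>The segment from \<open>Y\<close> to \<open>X\<close> can be prolonged beyond
  \<open>X\<close> inside the cone; \<open>e\<close> is the reciprocal of the domination
  constant.\<close>

lemma psd_form_extrapolate:
  fixes X Y :: "real ^ 'n ^ 'n"
  assumes X: "Finite_Cartesian_Product.transpose X = X" "psd_form X"
    and Y: "Finite_Cartesian_Product.transpose Y = Y"
    and ker: "\<And>u. X *v u = 0 \<Longrightarrow> Y *v u = 0"
  obtains e where "0 < e" "psd_form ((1 + e) *\<^sub>R X + (- e) *\<^sub>R Y)"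
proof -
  obtain c where c: "0 < c" "\<And>u. inner u (Y *v u) \<le> c * inner u (X *v u)"
    using psd_form_dominates[OF assms] by blast
  have "psd_form ((1 + 1 / c) *\<^sub>R X + (- (1 / c)) *\<^sub>R Y)"
    unfolding psd_form_def
  proof
    fix u
    have "0 \<le> inner u (X *v u)" "inner u (Y *v u) / c \<le> inner u (X *v u)"
      using X(2) c by (auto simp: psd_form_def field_simps)
    then have "0 \<le> inner u (X *v u) + inner u (X *v u) / c - inner u (Y *v u) / c"
      using c(1) by (smt (verit) divide_nonneg_pos)
    moreover have "((1 + 1 / c) *\<^sub>R X + (- (1 / c)) *\<^sub>R Y) *v u
        = (1 + 1 / c) *\<^sub>R (X *v u) + (- (1 / c)) *\<^sub>R (Y *v u)"
      by (simp only: matrix_vector_mult_add_rdistrib scaleR_matrix_vector_assoc)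
    ultimately show "0 \<le> inner u (((1 + 1 / c) *\<^sub>R X + (- (1 / c)) *\<^sub>R Y) *v u)"
      by (simp only: inner_add_right inner_scaleR_right) (simp add: algebra_simps)
  qed
  with c(1) show thesis
    by (intro that[of "1 / c"]) auto
qed

text \<open>The rank-one matrix with quadratic form \<open>(inner x u)\<^sup>2\<close>.\<close>

definition outer :: "real ^ 'n \<Rightarrow> real ^ 'n ^ 'n" where
  "outer x = (\<chi> i j. vec_nth x i * vec_nth x j)"

lemma outer_mult: "outer x *v u = inner x u *\<^sub>R x"
proof -
  have "vec_nth (outer x *v u) i = vec_nth (inner x u *\<^sub>R x) i" for i
    unfolding outer_def matrix_vector_mult_def inner_vec_def
    by (simp add: sum_distrib_right mult.assoc mult.commute[of "vec_nth x i"])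
  then show ?thesis
    by (simp add: Finite_Cartesian_Product.vec_eq_iff)
qed

text \<open>If \<open>X\<close> is nonzero, its kernel is a hyperplane with unit normal
  \<open>b\<close>, so \<open>X *v u\<close> depends on \<open>inner b u\<close> alone. By symmetry
  \<open>X *v b\<close> is a multiple \<open>l\<close> of \<open>b\<close>, and \<open>l\<close> is
  nonnegative, which gives \<open>x = sqrt l *\<^sub>R b\<close>.\<close>

lemma psd_form_rank_one:
  fixes X :: "real ^ 'n ^ 'n"
  assumes X: "Finite_Cartesian_Product.transpose X = X" "psd_form X"
    and dim: "CARD('n) \<le> dim {u. X *v u = 0} + 1"
  shows "\<exists>x. X = outer x"
proof (cases "X = 0")
  case True
  then have "X = outer 0" by (simp add: outer_def Finite_Cartesian_Product.zero_vec_def)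
  then show ?thesis by blast
next
  case False
  let ?N = "{u. X *v u = 0}"
  have sub: "subspace ?N"
    by (auto simp: subspace_def matrix_vector_right_distrib matrix_vector_mult_scaleR)
  have "?N \<noteq> UNIV"
    using False matrix_eq[of X 0] by auto
  then have "dim ?N \<noteq> DIM(real ^ 'n)"
    using dim_eq_full[of ?N] sub by (simp add: span_eq_iff[THEN iffD2])
  then have "dim ?N < DIM(real ^ 'n)"
    using dim_subset_UNIV[of ?N] by simp
  then obtain a where a: "a \<noteq> 0" "?N \<subseteq> {u. inner a u = 0}"
    using lowdim_subset_hyperplane[of ?N] sub by (auto simp: span_eq_iff[THEN iffD2])
  have "?N = {u. inner a u = 0}"
    using dim a by (intro subspace_dim_equal[OF sub subspace_hyperplane])
      (auto simp: dim_hyperplane)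
  define b where "b = a /\<^sub>R norm a"
  have b: "inner b b = 1" "X *v u = 0" if "inner b u = 0" for u
    using a \<open>?N = _\<close> that by (auto simp: b_def dot_square_norm power2_eq_square)
  have Xu: "X *v u = inner b u *\<^sub>R (X *v b)" for u
  proof -
    have "inner b (u - inner b u *\<^sub>R b) = 0"
      using b(1)[of 0] by (simp add: inner_diff_right)
    then have "X *v (u - inner b u *\<^sub>R b) = 0"
      by (rule b(2))
    then show ?thesis
      by (simp add: matrix_vector_mult_diff_distrib matrix_vector_mult_scaleR)
  qed
  define l where "l = inner b (X *v b)"
  have l: "0 \<le> l" using X(2) by (simp add: l_def psd_form_def)
  have "inner (X *v b) u = inner (l *\<^sub>R b) u" for u
  proof -
    have "inner (X *v b) u = inner b (X *v u)"
      using X(1) by (metis dot_lmul_matrix vector_transpose_matrix)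
    then show ?thesis
      by (subst (asm) Xu[of u]) (simp add: l_def)
  qed
  then have Xb: "X *v b = l *\<^sub>R b"
    using vector_eq_rdot by blast
  have "X *v u = outer (sqrt l *\<^sub>R b) *v u" for u
    using l by (simp add: outer_mult Xu[of u] Xb mult.assoc[symmetric])
  then have "X = outer (sqrt l *\<^sub>R b)"
    by (simp add: matrix_eq)
  then show ?thesis by blast
qed

section \<open>Lifts of quadrilaterals\<close>

lemma psd_cone_3_nonneg:
  assumes "X \<in> psd_cone 3"
  shows "0 \<le> a\<^sup>2 * X $$ (0, 0) + b\<^sup>2 * X $$ (1, 1) + c\<^sup>2 * X $$ (2, 2)
    + 2 * a * b * X $$ (0, 1) + 2 * a * c * X $$ (0, 2) + 2 * b * c * X $$ (1, 2)"
proof -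
  let ?v = "\<lambda>i :: nat. if i = 0 then a else if i = 1 then b else c"
  have sym: "X $$ (1, 0) = X $$ (0, 1)" "X $$ (2, 0) = X $$ (0, 2)" "X $$ (2, 1) = X $$ (1, 2)"
    using assms by (auto simp: psd_cone_def intro: sym_mats_index)
  have "0 \<le> (\<Sum>i<3. \<Sum>j<3. ?v i * X $$ (i, j) * ?v j)"
    using assms unfolding psd_cone_iff by (elim conjE) (erule spec)
  also have "\<dots> = a\<^sup>2 * X $$ (0, 0) + b\<^sup>2 * X $$ (1, 1) + c\<^sup>2 * X $$ (2, 2)
    + 2 * a * b * X $$ (0, 1) + 2 * a * c * X $$ (0, 2) + 2 * b * c * X $$ (1, 2)"
    using sym by (simp add: numeral_3_eq_3 numeral_2_eq_2 power2_eq_square algebra_simps)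
  finally show ?thesis .
qed

lemma psd_cone_3_diagonal:
  fixes a b c :: real
  assumes "0 \<le> a" "0 \<le> b" "0 \<le> c"
  defines "X \<equiv> Matrix.mat 3 3 (\<lambda>(i, j). if i = j then (if i = 0 then a else if i = 1 then b else c) else 0)"
  shows "X \<in> psd_cone 3"
proof -
  have "(\<Sum>i<3. \<Sum>j<3. v i * X $$ (i, j) * v j) = a * (v 0)\<^sup>2 + b * (v 1)\<^sup>2 + c * (v 2)\<^sup>2" for v
    by (simp add: X_def numeral_3_eq_3 numeral_2_eq_2 power2_eq_square algebra_simps)
  moreover have "X \<in> sym_mats 3"
    by (auto simp: X_def intro!: sym_matsI)
  ultimately show ?thesis
    using assms by (simp add: psd_cone_iff)
qed

lemma psd_cone_3_ones: "Matrix.mat 3 3 (\<lambda>_. 1) \<in> psd_cone 3"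
proof -
  have "(\<Sum>i<3. \<Sum>j<3. v i * Matrix.mat 3 3 (\<lambda>_. 1 :: real) $$ (i, j) * v j) = (v 0 + v 1 + v 2)\<^sup>2" for v
    by (simp add: numeral_3_eq_3 numeral_2_eq_2 power2_eq_square algebra_simps)
  moreover have "Matrix.mat 3 3 (\<lambda>_. 1 :: real) \<in> sym_mats 3"
    by (auto intro!: sym_matsI)
  ultimately show ?thesis
    by (simp add: psd_cone_iff)
qed

text \<open>The space consists of the matrices with equal off-diagonal entries, spanned by the
  diagonal matrices and the all-ones matrix, cut by a normalisation. The latter makes the
  coefficients of \<open>p1\<close>, \<open>p2\<close>, \<open>p3\<close> in \<open>f X\<close> sum
  to 1.\<close>

lemma quadrilateral_has_psd_lift:
  fixes P :: "(real ^ 'n) set"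
  assumes P: "polytope P" and ext: "{v. v extreme_point_of P} = {p1, p2, p3, p4}"
    and pos: "0 < A" "0 < B" "0 < C" "A - B + C = 1"
    and p4: "p4 = A *\<^sub>R p1 - B *\<^sub>R p2 + C *\<^sub>R p3"
  shows "has_psd_lift 3 P"
proof -
  define L where "L = {X \<in> sym_mats 3. X $$ (0, 1) = X $$ (0, 2) \<and> X $$ (0, 1) = X $$ (1, 2) \<and>
    A * X $$ (0, 0) + B * (X $$ (1, 1) - 2 * X $$ (0, 1)) + C * X $$ (2, 2) = 1}"
  define f where "f = (\<lambda>X :: real mat. (A * X $$ (0, 0)) *\<^sub>R p1
    + (B * (X $$ (1, 1) - 2 * X $$ (0, 1))) *\<^sub>R p2 + (C * X $$ (2, 2)) *\<^sub>R p3)"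
  have hull: "P = convex hull {p1, p2, p3, p4}"
    using P ext by (metis Krein_Milman_polytope polytope_def)
  have inP: "u1 *\<^sub>R p1 + u2 *\<^sub>R p2 + u3 *\<^sub>R p3 + u4 *\<^sub>R p4 \<in> P"
    if "0 \<le> u1" "0 \<le> u2" "0 \<le> u3" "0 \<le> u4" "u1 + u2 + u3 + u4 = 1" for u1 u2 u3 u4
  proof -
    have p: "p1 \<in> P" "p2 \<in> P" "p3 \<in> P" "p4 \<in> P"
      by (auto simp: hull hull_inc)
    have "(\<Sum>i<4. ([u1, u2, u3, u4] ! i) *\<^sub>R ([p1, p2, p3, p4] ! i)) \<in> P"
      using that p polytope_imp_convex[OF P]
      by (intro convex_sum) (auto simp: eval_nat_numeral less_Suc_eq)
    then show ?thesis
      by (simp add: eval_nat_numeral)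
  qed
  show ?thesis
  proof (rule has_psd_liftI[OF P, of 3 L f])
    show "affine_sym 3 L"
      unfolding affine_sym_def
    proof (intro conjI ballI allI impI)
      fix X Y and u v :: real assume XY: "X \<in> L" "Y \<in> L" and uv: "u + v = 1"
      then have s: "X \<in> sym_mats 3" "Y \<in> sym_mats 3" by (auto simp: L_def)
      let ?g = "\<lambda>X :: real mat. A * X $$ (0, 0) + B * (X $$ (1, 1) - 2 * X $$ (0, 1)) + C * X $$ (2, 2)"
      have g1: "?g X = 1" "?g Y = 1"
        using XY unfolding L_def by blast+
      have "?g (u \<cdot>\<^sub>m X + v \<cdot>\<^sub>m Y) = u * ?g X + v * ?g Y"
        by (simp add: index_combination[OF s] algebra_simps)
      then have "?g (u \<cdot>\<^sub>m X + v \<cdot>\<^sub>m Y) = 1"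
        unfolding g1 using uv by simp
      moreover have "(u \<cdot>\<^sub>m X + v \<cdot>\<^sub>m Y) $$ (0, 1) = (u \<cdot>\<^sub>m X + v \<cdot>\<^sub>m Y) $$ (0, 2)"
        "(u \<cdot>\<^sub>m X + v \<cdot>\<^sub>m Y) $$ (0, 1) = (u \<cdot>\<^sub>m X + v \<cdot>\<^sub>m Y) $$ (1, 2)"
        using XY by (auto simp: L_def index_combination[OF s])
      ultimately show "u \<cdot>\<^sub>m X + v \<cdot>\<^sub>m Y \<in> L"
        using sym_mats_combination[OF s] unfolding L_def by blast
    qed (auto simp: L_def)
    show "linear_sym 3 f"
      unfolding linear_sym_def f_def
      by (auto simp: sym_mats_def algebra_simps)
  next
    fix X assume X: "X \<in> psd_cone 3" "X \<in> L"
    let ?a = "A * X $$ (0, 0)" and ?b = "B * (X $$ (1, 1) - 2 * X $$ (0, 1))" and ?c = "C * X $$ (2, 2)"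
    have nn: "0 \<le> X $$ (0, 0)" "0 \<le> X $$ (2, 2)"
      using psd_diagonal_nonneg[OF X(1)] by auto
    have off: "X $$ (0, 2) = X $$ (0, 1)" "X $$ (1, 2) = X $$ (0, 1)" and sum: "?a + ?b + ?c = 1"
      using X by (auto simp: L_def)
    show "f X \<in> P"
    proof (cases "0 \<le> ?b")
      case True
      then show ?thesis
        using inP[of ?a ?b ?c 0] nn pos sum by (simp add: f_def)
    next
      case False
      \<comment> \<open>A negative coefficient of \<open>p2\<close> is traded for weight
        \<open>t\<close> on \<open>p4\<close>, using the relation between the four vertices.\<close>
      define t where "t = 2 * X $$ (0, 1) - X $$ (1, 1)"
      have b: "?b = - (B * t)" by (simp add: t_def algebra_simps)
      have t: "0 \<le> t"
        using False pos(2) unfolding b by (simp add: mult_le_0_iff)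
      \<comment> \<open>The test vectors (1, -1, 0) and (0, 1, -1) keep the weights left on
        \<open>p1\<close> and \<open>p3\<close> nonnegative.\<close>
      have "t \<le> X $$ (0, 0)" "t \<le> X $$ (2, 2)"
        using psd_cone_3_nonneg[OF X(1), of 1 "-1" 0] psd_cone_3_nonneg[OF X(1), of 0 1 "-1"] off
        by (auto simp: t_def)
      then have nonneg: "0 \<le> A * (X $$ (0, 0) - t)" "0 \<le> C * (X $$ (2, 2) - t)"
        using pos(1,3) by auto
      have "A * (X $$ (0, 0) - t) + 0 + C * (X $$ (2, 2) - t) + t = ?a + ?c - (A + C - 1) * t"
        by (simp add: algebra_simps)
      also have "A + C - 1 = B"
        using pos(4) by simp
      also have "?a + ?c - B * t = 1"
        using sum unfolding b by simp
      finally have "(A * (X $$ (0, 0) - t)) *\<^sub>R p1 + 0 *\<^sub>R p2 + (C * (X $$ (2, 2) - t)) *\<^sub>R p3 + t *\<^sub>R p4 \<in> P"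
        by (intro inP nonneg t order_refl)
      also have "(A * (X $$ (0, 0) - t)) *\<^sub>R p1 + 0 *\<^sub>R p2 + (C * (X $$ (2, 2) - t)) *\<^sub>R p3 + t *\<^sub>R p4 = f X"
        unfolding f_def b p4 by (simp add: algebra_simps)
      finally show ?thesis .
    qed
  next
    fix q assume "q extreme_point_of P"
    then consider "q = p1" | "q = p2" | "q = p3" | "q = p4"
      using ext by blast
    then show "\<exists>X \<in> psd_cone 3 \<inter> L. f X = q"
    proof cases
      case 1
      let ?X = "Matrix.mat 3 3 (\<lambda>(i, j). if i = j then (if i = 0 then 1 / A else if i = 1 then 0 else 0) else 0)"
      have "?X \<in> psd_cone 3" "?X \<in> L" "f ?X = q"
        using pos 1 psd_cone_3_diagonal[of "1 / A" 0 0] by (auto simp: L_def f_def psd_cone_def)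
      then show ?thesis by blast
    next
      case 2
      let ?X = "Matrix.mat 3 3 (\<lambda>(i, j). if i = j then (if i = 0 then 0 else if i = 1 then 1 / B else 0) else 0)"
      have "?X \<in> psd_cone 3" "?X \<in> L" "f ?X = q"
        using pos 2 psd_cone_3_diagonal[of 0 "1 / B" 0] by (auto simp: L_def f_def psd_cone_def)
      then show ?thesis by blast
    next
      case 3
      let ?X = "Matrix.mat 3 3 (\<lambda>(i, j). if i = j then (if i = 0 then 0 else if i = 1 then 0 else 1 / C) else 0)"
      have "?X \<in> psd_cone 3" "?X \<in> L" "f ?X = q"
        using pos 3 psd_cone_3_diagonal[of 0 0 "1 / C"] by (auto simp: L_def f_def psd_cone_def)
      then show ?thesis by blast
    next
      case 4
      let ?X = "Matrix.mat 3 3 (\<lambda>_. 1) :: real mat"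
      have "f ?X = q"
        by (simp add: 4 f_def p4)
      moreover have "?X \<in> psd_cone 3" "?X \<in> L"
        using pos(4) psd_cone_3_ones by (simp_all add: L_def psd_cone_def)
      ultimately show ?thesis by blast
    qed
  qed
qed

section \<open>The graph of a lift\<close>

text \<open>\<open>G\<close> is the graph of the projection on the affine space of the lift, with matrices padded by zeros to size
  \<open>CARD('m)\<close>; the padding is what makes the common kernel vector appear for smaller \<open>k\<close>.\<close>

lemma psd_lift_affine:
  fixes P :: "(real ^ 'n) set"
  assumes "has_psd_lift k P" "k \<le> CARD('m)"
  obtains G :: "((real ^ 'm ^ 'm) \<times> (real ^ 'n)) set"
    where "affine G" "\<And>X p. (X, p) \<in> G \<Longrightarrow> Finite_Cartesian_Product.transpose X = X"
      "P = {p. \<exists>X. (X, p) \<in> G \<and> psd_form X}"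
      "k < CARD('m) \<Longrightarrow> \<exists>e. e \<noteq> 0 \<and> (\<forall>X p. (X, p) \<in> G \<longrightarrow> X *v e = 0)"
proof -
  obtain L f where L: "affine_sym k L" and f: "linear_sym k f" and P: "P = f ` (psd_cone k \<inter> L)"
    using assms unfolding has_psd_lift_def by blast
  have Ls: "X \<in> sym_mats k" if "X \<in> L" for X
    using L that by (auto simp: affine_sym_def)
  obtain idx :: "'m \<Rightarrow> nat" where idx: "bij_betw idx UNIV {..<CARD('m)}"
    by (metis atLeast0LessThan ex_bij_betw_finite_nat finite)
  define emb :: "real mat \<Rightarrow> real ^ 'm ^ 'm" where
    "emb = (\<lambda>X. \<chi> i j. if idx i < k \<and> idx j < k then X $$ (idx i, idx j) else 0)"
  define G where "G = (\<lambda>X. (emb X, f X)) ` L"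
  have comb: "emb (u \<cdot>\<^sub>m X + v \<cdot>\<^sub>m Y) = u *\<^sub>R emb X + v *\<^sub>R emb Y"
    if "X \<in> sym_mats k" "Y \<in> sym_mats k" for X Y u v
    by (auto simp: Finite_Cartesian_Product.vec_eq_iff emb_def index_combination[OF that])
  \<comment> \<open>The padding contributes nothing to the form, and reindexing by
    \<open>idx\<close> returns the form of the unpadded matrix.\<close>
  have quad: "inner w (emb X *v w) = (\<Sum>i<k. \<Sum>j<k. z i * X $$ (i, j) * z j)"
    if z: "\<And>i. z (idx i) = vec_nth w i" for w X z
  proof -
    let ?g = "\<lambda>i j. if i < k \<and> j < k then z i * X $$ (i, j) * z j else 0"
    have "inner w (emb X *v w) = (\<Sum>i\<in>UNIV. \<Sum>j\<in>UNIV. vec_nth w i * (vec_nth (vec_nth (emb X) i) j * vec_nth w j))"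
      by (simp add: inner_vec_def matrix_vector_mult_def sum_distrib_left)
    also have "\<dots> = (\<Sum>i\<in>UNIV. \<Sum>j\<in>UNIV. ?g (idx i) (idx j))"
      by (intro sum.cong refl) (simp add: emb_def z)
    also have "\<dots> = (\<Sum>i\<in>UNIV. \<Sum>j<CARD('m). ?g (idx i) j)"
      by (intro sum.cong refl sum.reindex_bij_betw[OF idx])
    also have "\<dots> = (\<Sum>i<CARD('m). \<Sum>j<CARD('m). ?g i j)"
      by (rule sum.reindex_bij_betw[OF idx, of "\<lambda>i. \<Sum>j<CARD('m). ?g i j"])
    also have "\<dots> = (\<Sum>i<k. \<Sum>j<CARD('m). ?g i j)"
      using assms(2) by (intro sum.mono_neutral_right) auto
    also have "\<dots> = (\<Sum>i<k. \<Sum>j<k. ?g i j)"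
      using assms(2) by (intro sum.cong refl sum.mono_neutral_right) auto
    finally show ?thesis by simp
  qed
  have psd: "psd_form (emb X) \<longleftrightarrow> X \<in> psd_cone k" if "X \<in> sym_mats k" for X
  proof
    assume X: "X \<in> psd_cone k"
    show "psd_form (emb X)"
      unfolding psd_form_def
    proof
      fix w :: "real ^ 'm"
      have "inner w (emb X *v w) = (\<Sum>i<k. \<Sum>j<k. vec_nth w (inv_into UNIV idx i) * X $$ (i, j) * vec_nth w (inv_into UNIV idx j))"
        using idx by (intro quad) (simp add: bij_betw_def)
      then show "0 \<le> inner w (emb X *v w)"
        using X by (simp add: psd_cone_iff)
    qed
  next
    assume X: "psd_form (emb X)"
    have "0 \<le> (\<Sum>i<k. \<Sum>j<k. z i * X $$ (i, j) * z j)" for z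
    proof -
      have "inner (\<chi> i. z (idx i)) (emb X *v (\<chi> i. z (idx i))) = (\<Sum>i<k. \<Sum>j<k. z i * X $$ (i, j) * z j)"
        by (rule quad) simp
      then show ?thesis
        using X unfolding psd_form_def by (metis (no_types))
    qed
    then show "X \<in> psd_cone k"
      using that by (simp add: psd_cone_iff)
  qed
  show thesis
  proof
    show "affine G"
      unfolding affine_def
    proof (intro ballI allI impI)
      fix x y and u v :: real assume "x \<in> G" "y \<in> G" and uv: "u + v = 1"
      then obtain X Y where XY: "X \<in> L" "Y \<in> L" "x = (emb X, f X)" "y = (emb Y, f Y)"
        by (auto simp: G_def)
      then have "u *\<^sub>R x + v *\<^sub>R y = (emb (u \<cdot>\<^sub>m X + v \<cdot>\<^sub>m Y), f (u \<cdot>\<^sub>m X + v \<cdot>\<^sub>m Y))"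
        by (simp add: comb[OF Ls Ls] linear_sym_combination[OF f Ls Ls])
      moreover have "u \<cdot>\<^sub>m X + v \<cdot>\<^sub>m Y \<in> L"
        using L XY uv by (simp add: affine_sym_def)
      ultimately show "u *\<^sub>R x + v *\<^sub>R y \<in> G"
        by (simp add: G_def)
    qed
    show "Finite_Cartesian_Product.transpose X = X" if "(X, p) \<in> G" for X p
      using that sym_mats_index[OF Ls]
      by (auto simp: G_def emb_def Finite_Cartesian_Product.transpose_def Finite_Cartesian_Product.vec_eq_iff)
    show "P = {p. \<exists>X. (X, p) \<in> G \<and> psd_form X}"
      using psd[OF Ls] by (auto simp: P G_def)
    assume "k < CARD('m)"
    \<comment> \<open>An index outside the original block: every padded matrix annihilates its axis
      vector.\<close>
    then obtain l where l: "idx l = k"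
      using idx by (metis bij_betw_def imageE lessThan_iff)
    have "emb X *v axis l 1 = 0" for X
      using l by (simp add: matrix_vector_mul_component Finite_Cartesian_Product.vec_eq_iff inner_axis emb_def)
    then show "\<exists>e. e \<noteq> 0 \<and> (\<forall>X p. (X, p) \<in> G \<longrightarrow> X *v e = 0)"
      by (intro exI[of _ "axis l 1"]) (auto simp: G_def axis_eq_0_iff)
  qed
qed

section \<open>Convex polygons\<close>

text \<open>Twice the signed area of the triangle, positive when it runs counterclockwise. As a
  function of \<open>c\<close> it is the slack of \<open>c\<close> at the line through
  \<open>a\<close> and \<open>b\<close>.\<close>

definition orient :: "real ^ 2 \<Rightarrow> real ^ 2 \<Rightarrow> real ^ 2 \<Rightarrow> real" where
  "orient a b c = (vec_nth b 1 - vec_nth a 1) * (vec_nth c 2 - vec_nth a 2)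
    - (vec_nth b 2 - vec_nth a 2) * (vec_nth c 1 - vec_nth a 1)"

lemma orient_same [simp]: "orient a b a = 0" "orient a b b = 0"
  by (simp_all add: orient_def)

section \<open>Identities for signed areas\<close>

lemma orient_rotate: "orient b c a = orient a b c"
  by (simp add: orient_def algebra_simps)

lemma orient_swap: "orient b a c = - orient a b c"
  by (simp add: orient_def algebra_simps)

lemma orient_combination:
  assumes "u + v + w + t = 1"
  shows "orient a b (u *\<^sub>R p + v *\<^sub>R q + w *\<^sub>R r + t *\<^sub>R s)
    = u * orient a b p + v * orient a b q + w * orient a b r + t * orient a b s"
proof -
  have t: "t = 1 - u - v - w" using assms by simp
  show ?thesis by (simp add: t orient_def algebra_simps)
qed

lemma orient_sum: "orient b c u + orient c a u + orient a b u = orient a b c"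
  by (simp add: orient_def algebra_simps)

text \<open>Cramer's rule: barycentric coordinates are ratios of signed areas.\<close>

lemma orient_barycentric:
  "orient a b c *\<^sub>R u = orient b c u *\<^sub>R a + orient c a u *\<^sub>R b + orient a b u *\<^sub>R c"
  by (simp add: Finite_Cartesian_Product.vec_eq_iff forall_2 orient_def algebra_simps)

text \<open>Apply the affine function \<open>orient d e\<close>, which vanishes at \<open>d\<close>,
  to the barycentric expression of \<open>d\<close> in \<open>a\<close>, \<open>b\<close>,
  \<open>c\<close>.\<close>

lemma orient_pluecker:
  "orient b c d * orient d e a + orient c a d * orient d e b + orient a b d * orient d e c = 0"
  by (simp add: orient_def algebra_simps)

lemma in_triangle:
  assumes "0 < orient a b c" "0 \<le> orient a b u" "0 \<le> orient b c u" "0 \<le> orient c a u"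
  shows "u \<in> convex hull {a, b, c}"
proof -
  let ?d = "orient a b c"
  have "u = (1 / ?d) *\<^sub>R (?d *\<^sub>R u)"
    using assms(1) by simp
  also have "\<dots> = (orient b c u / ?d) *\<^sub>R a + (orient c a u / ?d) *\<^sub>R b + (orient a b u / ?d) *\<^sub>R c"
    by (subst orient_barycentric[of a b c u]) (simp add: scaleR_add_right)
  finally have "u = \<dots>" .
  moreover have "orient b c u / ?d + orient c a u / ?d + orient a b u / ?d = 1"
    using assms(1) orient_sum[of b c u a] by (simp add: add_divide_distrib[symmetric])
  moreover have "0 \<le> orient b c u / ?d" "0 \<le> orient c a u / ?d" "0 \<le> orient a b u / ?d"
    using assms by auto
  ultimately show ?thesis
    unfolding convex_hull_3 by blast
qed

section \<open>Points in convex position and their counterclockwise edges\<close>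

definition convex_position :: "'a::real_vector set \<Rightarrow> bool" where
  "convex_position E \<longleftrightarrow> (\<forall>v \<in> E. v \<notin> convex hull (E - {v}))"

text \<open>Strict positivity keeps further points of \<open>E\<close> off the line of the edge, and
  the orientation makes the next vertex well defined.\<close>

definition ccw_edge :: "(real ^ 2) set \<Rightarrow> real ^ 2 \<Rightarrow> real ^ 2 \<Rightarrow> bool" where
  "ccw_edge E a b \<longleftrightarrow> a \<in> E \<and> b \<in> E \<and> a \<noteq> b \<and> (\<forall>u \<in> E - {a, b}. 0 < orient a b u)"

lemma ccw_edge_pos: "ccw_edge E a b \<Longrightarrow> u \<in> E \<Longrightarrow> u \<noteq> a \<Longrightarrow> u \<noteq> b \<Longrightarrow> 0 < orient a b u"
  by (simp add: ccw_edge_def)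

lemma convex_position_not_in_hull:
  assumes "convex_position E" "u \<in> E" "S \<subseteq> E" "u \<notin> S"
  shows "u \<notin> convex hull S"
  using assms hull_mono[of S "E - {u}" convex] by (auto simp: convex_position_def)

text \<open>Gift wrapping: seen from a vertex \<open>v\<close>, all other vertices lie in an open half-plane, so they
  are ordered by slope, and the one of least slope is the next vertex.\<close>

lemma ccw_edge_exists:
  assumes E: "finite E" "convex_position E" "v \<in> E" "E \<noteq> {v}"
  shows "\<exists>w. ccw_edge E v w"
proof -
  let ?F = "E - {v}"
  have F: "finite ?F" "?F \<noteq> {}" using E by auto
  have "v \<notin> convex hull ?F"
    using E by (auto simp: convex_position_def)
  moreover have "closed (convex hull ?F)"
    using F by (simp add: compact_imp_closed finite_imp_compact_convex_hull)
  ultimately obtain a b where ab: "inner a v < b" "\<And>x. x \<in> convex hull ?F \<Longrightarrow> b < inner a x"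
    using separating_hyperplane_closed_point[of "convex hull ?F" v] by auto
  \<comment> \<open>Up to the length of \<open>a\<close>, \<open>h\<close> is the component along
    \<open>a\<close>, positive on the other points, and \<open>g\<close> the one along
    \<open>a\<close> turned by a right angle; \<open>g / h\<close> is the slope.\<close>
  define h where "h u = inner a (u - v)" for u
  define g where "g u = vec_nth a 1 * vec_nth (u - v) 2 - vec_nth a 2 * vec_nth (u - v) 1" for u
  have h: "0 < h u" if "u \<in> ?F" for u
    using ab(1) ab(2)[of u] that hull_inc[of u ?F] by (auto simp: h_def inner_diff_right)
  have h_eq: "h u = vec_nth a 1 * vec_nth (u - v) 1 + vec_nth a 2 * vec_nth (u - v) 2" for u
    by (simp add: h_def inner_vec_def sum_2)
  define N where "N = (vec_nth a 1)\<^sup>2 + (vec_nth a 2)\<^sup>2"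
  have "N \<noteq> 0"
  proof
    assume "N = 0"
    then have "h u = 0" for u by (simp add: N_def h_eq)
    then show False using h F by fastforce
  qed
  then have N: "0 < N" by (simp add: N_def less_le)
  have area: "N * orient v w u = h w * g u - g w * h u" for w u
    by (simp add: N_def orient_def h_eq g_def power2_eq_square algebra_simps)
  obtain w where w: "w \<in> ?F" "\<And>u. u \<in> ?F \<Longrightarrow> g w / h w \<le> g u / h u"
    using ex_is_arg_min_if_finite[OF F, of "\<lambda>u. g u / h u"] by (auto simp: is_arg_min_linorder)
  have "0 < orient v w u" if u: "u \<in> E - {v, w}" for u
  proof -
    have hu: "0 < h u" "0 < h w" using h u w by auto
    have "g w / h w \<le> g u / h u" using w u by auto
    then have "0 \<le> N * orient v w u"
      using hu by (simp add: area field_simps)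
    \<comment> \<open>Equal slopes would put \<open>w\<close> and \<open>u\<close> on one ray from
      \<open>v\<close>, and the nearer of the two would lie in the hull of \<open>v\<close> and the
      other.\<close>
    moreover have "orient v w u \<noteq> 0"
    proof
      assume "orient v w u = 0"
      define t where "t = h u / h w"
      have t: "0 < t" using hu by (simp add: t_def)
      have gh: "g u = t * g w" "h u = t * h w"
        using area[of w u] \<open>orient v w u = 0\<close> hu by (auto simp: t_def field_simps)
      \<comment> \<open>The inverse of the scaled rotation, recovering the coordinates from
        \<open>h\<close> and \<open>g\<close>.\<close>
      have comp: "N * vec_nth (x - v) 1 = vec_nth a 1 * h x - vec_nth a 2 * g x"
        "N * vec_nth (x - v) 2 = vec_nth a 2 * h x + vec_nth a 1 * g x" for x
        by (simp_all add: N_def h_eq g_def power2_eq_square algebra_simps)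
      have "N * vec_nth (u - v) 1 = t * (N * vec_nth (w - v) 1)" "N * vec_nth (u - v) 2 = t * (N * vec_nth (w - v) 2)"
        unfolding comp gh by (simp_all add: algebra_simps)
      then have "vec_nth (u - v) 1 = t * vec_nth (w - v) 1" "vec_nth (u - v) 2 = t * vec_nth (w - v) 2"
        using N by auto
      then have uv: "u - v = t *\<^sub>R (w - v)"
        by (simp add: Finite_Cartesian_Product.vec_eq_iff forall_2)
      show False
      proof (cases "t \<le> 1")
        case True
        have "u = (1 - t) *\<^sub>R v + t *\<^sub>R w"
          using uv by (simp add: algebra_simps)
        then have "u \<in> convex hull {v, w}"
          unfolding convex_hull_2 using t True
          by (intro CollectI exI[of _ "1 - t"] exI[of _ t]) auto
        then show False
          using convex_position_not_in_hull[of E u "{v, w}"] E u w by auto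
      next
        case False
        have "w - v = (1 / t) *\<^sub>R (u - v)"
          using uv t by simp
        then have "w = (1 - 1 / t) *\<^sub>R v + (1 / t) *\<^sub>R u"
          by (simp add: algebra_simps)
        then have "w \<in> convex hull {v, u}"
          unfolding convex_hull_2 using t False
          by (intro CollectI exI[of _ "1 - 1 / t"] exI[of _ "1 / t"]) auto
        then show False
          using convex_position_not_in_hull[of E w "{v, u}"] E u w by auto
      qed
    qed
    ultimately show ?thesis
      using N by (simp add: zero_le_mult_iff)
  qed
  then have "ccw_edge E v w"
    using E w by (auto simp: ccw_edge_def)
  then show ?thesis ..
qed

section \<open>Short cycles and longer paths of edges\<close>

lemma ccw_edge_asym:
  assumes "ccw_edge E a b" "ccw_edge E b a"
  shows "E = {a, b}"
proof (rule ccontr)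
  assume "E \<noteq> {a, b}"
  then obtain u where "u \<in> E - {a, b}"
    using assms by (auto simp: ccw_edge_def)
  then have "0 < orient a b u" "0 < orient b a u"
    using assms by (auto simp: ccw_edge_def)
  then show False
    by (simp add: orient_swap[of a b])
qed

lemma ccw_edge_inj:
  assumes "ccw_edge E a c" "ccw_edge E b c"
  shows "a = b"
proof (rule ccontr)
  assume "a \<noteq> b"
  then have "0 < orient a c b" "0 < orient b c a"
    using assms by (auto simp: ccw_edge_def)
  then show False
    using orient_rotate[of b c a] orient_rotate[of c a b] orient_swap[of a c b] by simp
qed

text \<open>Any further point would lie to the left of all three edges, hence in the triangle,
  against convex position.\<close>

lemma ccw_triangle:
  assumes "convex_position E" "ccw_edge E a b" "ccw_edge E b c" "ccw_edge E c a"
  shows "E = {a, b, c}"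
proof -
  have mem: "a \<in> E" "b \<in> E" "c \<in> E" "c \<noteq> a" "c \<noteq> b"
    using assms by (auto simp: ccw_edge_def)
  have "u \<in> {a, b, c}" if "u \<in> E" for u
  proof (rule ccontr)
    assume "u \<notin> {a, b, c}"
    moreover from this have "u \<in> convex hull {a, b, c}"
      using mem that assms(2-4)[THEN ccw_edge_pos, of u] ccw_edge_pos[OF assms(2), of c]
      by (intro in_triangle) auto
    ultimately show False
      using convex_position_not_in_hull[of E u "{a, b, c}"] assms mem that by auto
  qed
  then show ?thesis using mem by auto
qed

text \<open>As for triangles, after cutting along the diagonal through \<open>a\<close> and
  \<open>c\<close>.\<close>

lemma ccw_quadrilateral:
  assumes "convex_position E" "ccw_edge E a b" "ccw_edge E b c" "ccw_edge E c d" "ccw_edge E d a"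
    and "a \<noteq> c" "b \<noteq> d"
  shows "E = {a, b, c, d}"
proof -
  have mem: "a \<in> E" "b \<in> E" "c \<in> E" "d \<in> E"
    and ne: "a \<noteq> b" "b \<noteq> c" "c \<noteq> d" "d \<noteq> a"
    using assms(2-5) by (simp_all add: ccw_edge_def)
  have "u \<in> {a, b, c, d}" if "u \<in> E" for u
  proof (rule ccontr)
    assume u: "u \<notin> {a, b, c, d}"
    have pos: "0 < orient a b u" "0 < orient b c u" "0 < orient c d u" "0 < orient d a u"
      "0 < orient a b c" "0 < orient c d a"
      using u that mem ne assms(6) assms(2-5)[THEN ccw_edge_pos, of u] ccw_edge_pos[OF assms(2), of c]
        ccw_edge_pos[OF assms(4), of a] by (blast, blast, blast, blast, blast, metis)
    have "u \<in> convex hull {a, b, c} \<or> u \<in> convex hull {a, c, d}"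
    proof (cases "0 \<le> orient c a u")
      case True
      then show ?thesis
        using in_triangle[of a b c u] pos by linarith
    next
      case False
      then have "0 \<le> orient a c u" by (simp add: orient_swap[of c a])
      then show ?thesis
        using in_triangle[of a c d u] pos orient_rotate[of c d a] by linarith
    qed
    then show False
      using convex_position_not_in_hull[of E u "{a, b, c}"] convex_position_not_in_hull[of E u "{a, c, d}"]
        assms(1) mem that u by blast
  qed
  then show ?thesis using mem by blast
qed

text \<open>Follow the edges from any point; closing up after two or three of them would leave
  \<open>E\<close> with fewer than four points.\<close>

lemma ccw_path_4:
  assumes E: "finite E" "convex_position E" "4 \<le> card E"
  obtains a b c d where "ccw_edge E a b" "ccw_edge E b c" "ccw_edge E c d" "distinct [a, b, c, d]"
proof -
  obtain a where a: "a \<in> E" using E by fastforce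
  have ne: "E \<noteq> S" if "card S < 4" for S using E that by auto
  have next_vertex: "\<exists>w. ccw_edge E v w" if "v \<in> E" for v
    using ccw_edge_exists[OF E(1,2) that] ne[of "{v}"] by simp
  obtain b where ab: "ccw_edge E a b" using next_vertex a by blast
  then obtain c where bc: "ccw_edge E b c" using next_vertex unfolding ccw_edge_def by meson
  then obtain d where cd: "ccw_edge E c d" using next_vertex unfolding ccw_edge_def by meson
  have ne2: "E \<noteq> {x, y}" for x y
    using ne[of "{x, y}"] card_length[of "[x, y]"] by simp
  have "c \<noteq> a" using ccw_edge_asym ab bc ne2 by blast
  moreover have "d \<noteq> b" using ccw_edge_asym bc cd ne2 by blast
  moreover have "d \<noteq> a"
  proof
    assume "d = a"
    then have "E = {a, b, c}" using ccw_triangle[OF E(2) ab bc] cd by simp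
    moreover have "card {a, b, c} < 4" using card_length[of "[a, b, c]"] by simp
    ultimately show False using ne by blast
  qed
  ultimately show thesis
    using that ab bc cd by (auto simp: ccw_edge_def)
qed

text \<open>The last step cannot return to \<open>b\<close> or \<open>c\<close>, since predecessors
  are unique, and a return to \<open>a\<close> would close a quadrilateral.\<close>

lemma ccw_path_5:
  assumes E: "finite E" "convex_position E" "5 \<le> card E"
  obtains a b c d e where "ccw_edge E a b" "ccw_edge E b c" "ccw_edge E c d" "ccw_edge E d e"
    "distinct [a, b, c, d, e]"
proof -
  obtain a b c d where p: "ccw_edge E a b" "ccw_edge E b c" "ccw_edge E c d" "distinct [a, b, c, d]"
    by (rule ccw_path_4[OF E(1,2)]) (use E(3) in auto)
  have d: "d \<in> E" using p by (auto simp: ccw_edge_def)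
  have "E \<noteq> {d}" using E by auto
  then obtain e where de: "ccw_edge E d e"
    using ccw_edge_exists[OF E(1,2) d] by blast
  have "e \<noteq> b" using ccw_edge_inj[of E a b d] p de by auto
  moreover have "e \<noteq> c" using ccw_edge_inj[of E b c d] p de by auto
  moreover have "e \<noteq> a"
  proof
    assume "e = a"
    then have "E = {a, b, c, d}" using ccw_quadrilateral[OF E(2) p(1-3)] de p by simp
    moreover have "card {a, b, c, d} \<le> 4" using card_length[of "[a, b, c, d]"] by simp
    ultimately show False using E by simp
  qed
  ultimately show thesis
    using that p de by (auto simp: ccw_edge_def)
qed

section \<open>The slacks of an edge are squares\<close>

text \<open>Cauchy-Schwarz in the plane, by Lagrange's identity.\<close>

lemma square_combination_le: "(\<alpha> * A + \<beta> * B)\<^sup>2 \<le> (\<alpha>\<^sup>2 + \<beta>\<^sup>2) * (A\<^sup>2 + B\<^sup>2)" for \<alpha> \<beta> A B :: real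
proof -
  have "(\<alpha>\<^sup>2 + \<beta>\<^sup>2) * (A\<^sup>2 + B\<^sup>2) - (\<alpha> * A + \<beta> * B)\<^sup>2 = (\<alpha> * B - \<beta> * A)\<^sup>2"
    by (simp add: power2_eq_square algebra_simps)
  then show ?thesis
    by (metis diff_ge_0_iff_ge zero_le_power2)
qed

text \<open>The affine combination with weights \<open>\<delta>\<close> on the fourth form and \<open>- \<delta> * \<gamma>\<^sup>2\<close> on the third has no
  \<open>V\<^sup>2\<close> term, so a correction of order \<open>\<delta>\<^sup>2\<close> makes it positive semidefinite, whatever the
  sign of \<open>\<delta>\<close>.\<close>

lemma slack_ratio:
  fixes \<alpha> \<beta> \<gamma> s t :: real
  assumes nonneg: "\<And>a b c d. a + b + c + d = 1 \<Longrightarrow>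
      (\<And>A B V. 0 \<le> a * A\<^sup>2 + b * B\<^sup>2 + c * V\<^sup>2 + d * (\<alpha> * A + \<beta> * B + \<gamma> * V)\<^sup>2) \<Longrightarrow> 0 \<le> c * s + d * t"
    and s: "0 \<le> s"
  shows "t = \<gamma>\<^sup>2 * s"
proof (rule ccontr)
  assume "t \<noteq> \<gamma>\<^sup>2 * s"
  define r where "r = t - \<gamma>\<^sup>2 * s"
  have r: "r \<noteq> 0" using \<open>t \<noteq> _\<close> by (simp add: r_def)
  \<comment> \<open>\<open>m\<close> bounds the square of \<open>\<alpha> * A + \<beta> * B\<close>,
    \<open>K\<close> is large enough to absorb the mixed term, and \<open>M\<close> collects the
    losses in the lower bound for \<open>a\<close>.\<close>
  define m K M where "m = \<alpha>\<^sup>2 + \<beta>\<^sup>2" and "K = 4 * \<gamma>\<^sup>2 * m + 1" and "M = 1 + \<gamma>\<^sup>2 + 2 * m + K"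
  have m: "0 \<le> m" and K: "1 \<le> K" and M: "1 \<le> M"
    by (auto simp: m_def K_def M_def add_nonneg_nonneg)
  define \<epsilon> where "\<epsilon> = min (1 / (2 * M)) (\<bar>r\<bar> / (2 * (K * s + 1)))"
  have Ks: "0 \<le> K * s" using K s by simp
  have \<epsilon>: "0 < \<epsilon>" "\<epsilon> * M \<le> 1 / 2" "\<epsilon> * (K * s) < \<bar>r\<bar>"
  proof -
    show "0 < \<epsilon>" using r M Ks by (simp add: \<epsilon>_def)
    have "\<epsilon> * M \<le> 1 / (2 * M) * M"
      using M by (intro mult_right_mono) (auto simp: \<epsilon>_def)
    then show "\<epsilon> * M \<le> 1 / 2" using M by simp
    have "\<epsilon> * (K * s) \<le> \<bar>r\<bar> / (2 * (K * s + 1)) * (K * s)"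
      using Ks by (intro mult_right_mono) (auto simp: \<epsilon>_def)
    also have "\<dots> = \<bar>r\<bar> * (K * s / (2 * (K * s + 1)))"
      by simp
    also have "\<dots> < \<bar>r\<bar> * 1"
      using Ks r by (intro mult_strict_left_mono) (auto simp: divide_less_eq)
    finally show "\<epsilon> * (K * s) < \<bar>r\<bar>" by simp
  qed
  have "\<epsilon> * 1 \<le> \<epsilon> * M" using M \<epsilon>(1) by (intro mult_left_mono) auto
  then have \<epsilon>1: "\<epsilon> \<le> 1" using \<epsilon>(2) by linarith
  \<comment> \<open>The sign is opposite to that of the defect \<open>r\<close>, so that the
    first-order change of the slack is negative.\<close>
  define \<delta> where "\<delta> = - sgn r * \<epsilon>"
  have \<delta>: "\<bar>\<delta>\<bar> = \<epsilon>" "\<delta> * r = - \<epsilon> * \<bar>r\<bar>" "\<delta>\<^sup>2 = \<epsilon>\<^sup>2"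
    using r \<epsilon>(1) by (auto simp: \<delta>_def abs_mult sgn_if)
  \<comment> \<open>\<open>c\<close> is the cancelling weight plus the second-order correction; the
    rest of the total weight 1 is split evenly between the first two forms.\<close>
  define a c where "a = (1 - \<delta> + \<delta> * \<gamma>\<^sup>2 - K * \<delta>\<^sup>2) / 2" and "c = K * \<delta>\<^sup>2 - \<delta> * \<gamma>\<^sup>2"
  have a: "1 / 4 + \<epsilon> * m \<le> a"
  proof -
    have "\<epsilon>\<^sup>2 \<le> \<epsilon>" using \<epsilon>(1) \<epsilon>1 by (simp add: power2_eq_square mult_left_le)
    then have "K * \<delta>\<^sup>2 \<le> K * \<epsilon>" using K \<delta>(3) by simp
    moreover have "\<delta> \<le> \<epsilon>" using \<delta>(1) by linarith
    moreover have "- \<epsilon> * \<gamma>\<^sup>2 \<le> \<delta> * \<gamma>\<^sup>2"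
      using \<delta>(1) by (intro mult_right_mono) auto
    moreover have "\<epsilon> * M = \<epsilon> + \<epsilon> * \<gamma>\<^sup>2 + 2 * (\<epsilon> * m) + K * \<epsilon>"
      by (simp add: M_def algebra_simps)
    ultimately show ?thesis using \<epsilon>(2) by (simp add: a_def)
  qed
  have "0 \<le> a * A\<^sup>2 + a * B\<^sup>2 + c * V\<^sup>2 + \<delta> * (\<alpha> * A + \<beta> * B + \<gamma> * V)\<^sup>2" for A B V
  proof -
    define T where "T = \<alpha> * A + \<beta> * B"
    have T: "T\<^sup>2 \<le> m * (A\<^sup>2 + B\<^sup>2)"
      unfolding T_def m_def by (rule square_combination_le)
    \<comment> \<open>Completing the square absorbs the mixed term in \<open>V\<close> and
      \<open>T\<close>, at the cost of the correction and at most a quarter of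
      \<open>A\<^sup>2 + B\<^sup>2\<close>.\<close>
    have "0 \<le> (K * \<delta> * V + \<gamma> * T)\<^sup>2 / K"
      using K by simp
    also have "\<dots> = K * \<delta>\<^sup>2 * V\<^sup>2 + 2 * \<delta> * \<gamma> * V * T + \<gamma>\<^sup>2 * T\<^sup>2 / K"
      using K by (simp add: power2_eq_square field_simps)
    finally have 1: "0 \<le> K * \<delta>\<^sup>2 * V\<^sup>2 + 2 * \<delta> * \<gamma> * V * T + \<gamma>\<^sup>2 * T\<^sup>2 / K" .
    have "\<gamma>\<^sup>2 * T\<^sup>2 \<le> \<gamma>\<^sup>2 * (m * (A\<^sup>2 + B\<^sup>2))"
      using T by (intro mult_left_mono) auto
    also have "4 * \<dots> \<le> K * (A\<^sup>2 + B\<^sup>2)"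
      by (simp add: K_def algebra_simps)
    finally have 2: "\<gamma>\<^sup>2 * T\<^sup>2 / K \<le> (A\<^sup>2 + B\<^sup>2) / 4"
      using K by (simp add: field_simps)
    have "- \<epsilon> * T\<^sup>2 \<le> \<delta> * T\<^sup>2"
      using \<delta>(1) by (intro mult_right_mono) auto
    moreover have "\<epsilon> * T\<^sup>2 \<le> \<epsilon> * (m * (A\<^sup>2 + B\<^sup>2))"
      using T \<epsilon>(1) by (intro mult_left_mono) auto
    moreover have "(1 / 4 + \<epsilon> * m) * (A\<^sup>2 + B\<^sup>2) \<le> a * (A\<^sup>2 + B\<^sup>2)"
      using a by (intro mult_right_mono) auto
    ultimately have 3: "0 \<le> a * (A\<^sup>2 + B\<^sup>2) + \<delta> * T\<^sup>2 - (A\<^sup>2 + B\<^sup>2) / 4"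
      by (simp add: algebra_simps)
    have "a * A\<^sup>2 + a * B\<^sup>2 + c * V\<^sup>2 + \<delta> * (T + \<gamma> * V)\<^sup>2
        = a * (A\<^sup>2 + B\<^sup>2) + \<delta> * T\<^sup>2 + K * \<delta>\<^sup>2 * V\<^sup>2 + 2 * \<delta> * \<gamma> * V * T"
      by (simp add: c_def power2_eq_square algebra_simps)
    then show ?thesis
      using 1 2 3 unfolding T_def by linarith
  qed
  moreover have "a + a + c + \<delta> = 1"
    by (simp add: a_def c_def field_simps)
  ultimately have "0 \<le> c * s + \<delta> * t"
    using nonneg by blast
  also have "\<dots> = \<epsilon> * (\<epsilon> * (K * s) - \<bar>r\<bar>)"
    using \<delta>(2,3) by (simp add: c_def r_def power2_eq_square algebra_simps)
  also have "\<dots> < 0"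
    using \<epsilon> by (simp add: mult_pos_neg)
  finally show False by simp
qed

lemma affine_combination_4:
  assumes "affine G" "x \<in> G" "y \<in> G" "z \<in> G" "w \<in> G" "a + b + c + d = 1"
  shows "a *\<^sub>R x + b *\<^sub>R y + c *\<^sub>R z + d *\<^sub>R w \<in> G"
proof -
  have S: "subspace ((\<lambda>v. v - x) ` G)"
    using assms affine_diffs_subspace_subtract by blast
  then have "b *\<^sub>R (y - x) + c *\<^sub>R (z - x) + d *\<^sub>R (w - x) \<in> (\<lambda>v. v - x) ` G"
    using assms by (intro subspace_add subspace_scale) auto
  then obtain g where g: "g \<in> G" "b *\<^sub>R (y - x) + c *\<^sub>R (z - x) + d *\<^sub>R (w - x) = g - x"
    by auto
  have "a *\<^sub>R x + b *\<^sub>R y + c *\<^sub>R z + d *\<^sub>R w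
      = (a + b + c + d) *\<^sub>R x + (b *\<^sub>R (y - x) + c *\<^sub>R (z - x) + d *\<^sub>R (w - x))"
    by (simp add: algebra_simps)
  then have "a *\<^sub>R x + b *\<^sub>R y + c *\<^sub>R z + d *\<^sub>R w = g"
    by (simp only: assms(6) g(2)) simp
  then show ?thesis using g by simp
qed

lemma span_of_independent_triple:
  fixes a b c y :: "real ^ 3"
  assumes ind: "\<And>r s t. r *\<^sub>R a + s *\<^sub>R b + t *\<^sub>R c = 0 \<Longrightarrow> r = 0 \<and> s = 0 \<and> t = 0"
  obtains r s t where "y = r *\<^sub>R a + s *\<^sub>R b + t *\<^sub>R c"
proof -
  have c0: "c \<noteq> 0" using ind[of 0 0 1] by auto
  have bc: "b \<notin> span {c}"
  proof
    assume "b \<in> span {c}"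
    then obtain k where "b = k *\<^sub>R c" by (auto simp: span_singleton)
    then show False using ind[of 0 1 "- k"] by auto
  qed
  have abc: "a \<notin> span {b, c}"
  proof
    assume "a \<in> span {b, c}"
    then obtain k l where "a - k *\<^sub>R b = l *\<^sub>R c" by (auto simp: span_breakdown_eq[of _ b] span_singleton)
    then show False using ind[of 1 "- k" "- l"] by (auto simp: algebra_simps)
  qed
  have ne: "b \<noteq> c" "a \<notin> {b, c}"
    using bc abc by (auto intro: span_base)
  have "independent {a, b, c}"
    using c0 bc abc ne by (simp add: independent_insert)
  moreover have "card {a, b, c} = 3"
    using ne by simp
  ultimately have "UNIV \<subseteq> span {a, b, c}"
    by (intro card_ge_dim_independent) auto
  then have "y \<in> span {a, b, c}" by blast
  then obtain r s t where "y - r *\<^sub>R a - s *\<^sub>R b = t *\<^sub>R c"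
    by (auto simp: span_breakdown_eq[of _ a] span_breakdown_eq[of _ b] span_singleton)
  then have "y = r *\<^sub>R a + s *\<^sub>R b + t *\<^sub>R c"
    by (simp add: algebra_simps)
  then show thesis ..
qed

text \<open>A psd matrix can be extrapolated away from any other one whose kernel contains its own. So extremality
  of \<open>v\<close> gives a kernel vector that the fibre of \<open>w\<close> does not share, and the supporting line through
  \<open>v\<close> and \<open>w\<close> gives a nonzero common one.\<close>

lemma extreme_fibre_rank_one:
  fixes G :: "((real ^ 'm ^ 'm) \<times> (real ^ 2)) set"
  assumes G: "affine G" "\<And>X p. (X, p) \<in> G \<Longrightarrow> Finite_Cartesian_Product.transpose X = X"
    and P: "P = {p. \<exists>X. (X, p) \<in> G \<and> psd_form X}"
    and v: "v extreme_point_of P" and w: "w \<in> P" "w \<noteq> v" and u: "u \<in> P" "0 < orient v w u"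
    and nonneg: "\<And>p. p \<in> P \<Longrightarrow> 0 \<le> orient v w p"
    and m: "CARD('m) \<le> 3"
  obtains x where "(outer x, v) \<in> G"
proof -
  obtain X where X: "(X, v) \<in> G" "psd_form X" using v P by (auto simp: extreme_point_of_def)
  obtain Y where Y: "(Y, w) \<in> G" "psd_form Y" using w P by auto
  obtain U where U: "(U, u) \<in> G" "psd_form U" using u P by auto
  note sym = X(1)[THEN G(2)] Y(1)[THEN G(2)] U(1)[THEN G(2)]
  have extrapolate: "\<exists>e>0. (1 + e) *\<^sub>R p - e *\<^sub>R q \<in> P"
    if A: "(A, p) \<in> G" "psd_form A" "(B, q) \<in> G" "\<And>u. A *v u = 0 \<Longrightarrow> B *v u = 0" for A B p q
  proof -
    obtain e where e: "0 < e" "psd_form ((1 + e) *\<^sub>R A + (- e) *\<^sub>R B)"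
      by (rule psd_form_extrapolate[OF G(2)[OF A(1)] A(2) G(2)[OF A(3)] A(4)])
    have "(1 + e) *\<^sub>R (A, p) + (- e) *\<^sub>R (B, q) \<in> G"
      using G(1) A by (intro mem_affine) auto
    then show ?thesis
      using e unfolding P by auto
  qed
  have "CARD('m) \<le> dim {z. X *v z = 0} + 1"
  proof -
    \<comment> \<open>Otherwise one could extrapolate from \<open>w\<close> beyond \<open>v\<close>
      within \<open>P\<close>, and \<open>v\<close> would be interior to a segment.\<close>
    have "\<exists>n. X *v n = 0 \<and> Y *v n \<noteq> 0"
    proof (rule ccontr)
      assume "\<not> ?thesis"
      then obtain e where e: "0 < e" "(1 + e) *\<^sub>R v - e *\<^sub>R w \<in> P"
        using extrapolate[OF X Y(1)] by blast
      let ?p = "(1 + e) *\<^sub>R v - e *\<^sub>R w"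
      have "?p - w = (1 + e) *\<^sub>R (v - w)" by (simp add: algebra_simps)
      then have "?p \<noteq> w" using e(1) w(2) by auto
      have "v = (1 - e / (1 + e)) *\<^sub>R ?p + (e / (1 + e)) *\<^sub>R w"
      proof -
        have "1 - e / (1 + e) = 1 / (1 + e)" using e(1) by (simp add: field_simps)
        then have "(1 - e / (1 + e)) *\<^sub>R ?p = v - (e / (1 + e)) *\<^sub>R w"
          using e(1) by (simp add: scaleR_diff_right)
        then show ?thesis by simp
      qed
      then have "v \<in> open_segment ?p w"
        using e(1) \<open>?p \<noteq> w\<close> unfolding in_segment
        by (intro conjI exI[of _ "e / (1 + e)"]) auto
      then show False
        using v e(2) w(1) by (auto simp: extreme_point_of_def)
    qed
    then obtain n where n: "X *v n = 0" "Y *v n \<noteq> 0" by blast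
    \<comment> \<open>The kernel of the midpoint \<open>?M\<close> is the common kernel. Were it
      zero, one could extrapolate from \<open>u\<close> through the midpoint of \<open>v\<close> and
      \<open>w\<close> across the supporting line.\<close>
    have "\<exists>z. z \<noteq> 0 \<and> X *v z = 0 \<and> Y *v z = 0"
    proof (rule ccontr)
      assume none: "\<not> ?thesis"
      let ?M = "(1 / 2) *\<^sub>R X + (1 / 2) *\<^sub>R Y"
      have M: "inner z (?M *v z) = (inner z (X *v z) + inner z (Y *v z)) / 2" for z
        unfolding matrix_vector_mult_add_rdistrib scaleR_matrix_vector_assoc[symmetric] inner_add_right
        by simp
      have "(1 / 2) *\<^sub>R (X, v) + (1 / 2) *\<^sub>R (Y, w) \<in> G"
        using G(1) X Y by (intro mem_affine) auto
      then have MG: "(?M, (1 / 2) *\<^sub>R v + (1 / 2) *\<^sub>R w) \<in> G" by simp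
      have psdM: "psd_form ?M"
        using X(2) Y(2) unfolding psd_form_def M by (simp add: add_nonneg_nonneg)
      have ker: "U *v z = 0" if "?M *v z = 0" for z
      proof -
        have "inner z (X *v z) + inner z (Y *v z) = 0" using M[of z] that by simp
        moreover have "0 \<le> inner z (X *v z)" "0 \<le> inner z (Y *v z)"
          using X(2) Y(2) by (auto simp: psd_form_def)
        ultimately have "inner z (X *v z) = 0" "inner z (Y *v z) = 0" by linarith+
        then have "X *v z = 0" "Y *v z = 0"
          using psd_form_kernel[OF sym(1) X(2)] psd_form_kernel[OF sym(2) Y(2)] by blast+
        then have "z = 0" using none by blast
        then show ?thesis by simp
      qed
      then obtain e where e: "0 < e" "(1 + e) *\<^sub>R ((1 / 2) *\<^sub>R v + (1 / 2) *\<^sub>R w) - e *\<^sub>R u \<in> P"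
        using extrapolate[OF MG psdM U(1) ker] by blast
      have "orient v w ((1 + e) *\<^sub>R ((1 / 2) *\<^sub>R v + (1 / 2) *\<^sub>R w) - e *\<^sub>R u)
          = orient v w (((1 + e) / 2) *\<^sub>R v + ((1 + e) / 2) *\<^sub>R w + (- e) *\<^sub>R u + 0 *\<^sub>R u)"
        by (simp add: scaleR_add_right)
      also have "\<dots> = - e * orient v w u"
        by (subst orient_combination) auto
      also have "\<dots> < 0" using e u by simp
      finally show False using nonneg[OF e(2)] by simp
    qed
    then obtain z where z: "z \<noteq> 0" "X *v z = 0" "Y *v z = 0" by blast
    \<comment> \<open>\<open>Y\<close> annihilates \<open>z\<close> but not \<open>n\<close>, so the
      kernel of \<open>X\<close> has dimension at least two.\<close>
    have "n \<notin> span {z}"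
      using n z by (auto simp: span_singleton matrix_vector_mult_scaleR)
    then have "independent {n, z}" "n \<noteq> z"
      using z n by (auto simp: independent_insert)
    moreover have "{n, z} \<subseteq> {z. X *v z = 0}" using n z by auto
    ultimately have "card {n, z} \<le> dim {z. X *v z = 0}"
      by (intro independent_card_le_dim)
    then show ?thesis using \<open>n \<noteq> z\<close> m by simp
  qed
  then obtain x where "X = outer x"
    using psd_form_rank_one X(2) sym(1) by blast
  then show thesis using that X(1) by blast
qed

text \<open>All that is retained of a lift: each vertex carries a vector, and an affine combination
  of vertices stays in \<open>P\<close> whenever the same combination of the squared linear forms is
  nonnegative.\<close>

locale psd_polygon =
  fixes P E :: "(real ^ 2) set" and x :: "real ^ 2 \<Rightarrow> real ^ 3"
  assumes bounded: "bounded P"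
    and edge_nonneg: "ccw_edge E v w \<Longrightarrow> p \<in> P \<Longrightarrow> 0 \<le> orient v w p"
    and combination: "p \<in> E \<Longrightarrow> q \<in> E \<Longrightarrow> r \<in> E \<Longrightarrow> s \<in> E \<Longrightarrow> a + b + c + d = 1 \<Longrightarrow>
      (\<And>u. 0 \<le> a * (inner (x p) u)\<^sup>2 + b * (inner (x q) u)\<^sup>2 + c * (inner (x r) u)\<^sup>2 + d * (inner (x s) u)\<^sup>2) \<Longrightarrow>
      a *\<^sub>R p + b *\<^sub>R q + c *\<^sub>R r + d *\<^sub>R s \<in> P"
begin

text \<open>Parallel vectors would have proportional forms, so a whole ray of the line through
  \<open>v\<close> and \<open>w\<close> would lie in the bounded set \<open>P\<close>.\<close>

lemma not_parallel:
  assumes "v \<in> E" "w \<in> E" "v \<noteq> w"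
  shows "x v \<noteq> t *\<^sub>R x w"
proof
  assume eq: "x v = t *\<^sub>R x w"
  obtain B where B: "\<And>p. p \<in> P \<Longrightarrow> norm p \<le> B"
    using bounded by (auto simp: bounded_iff)
  have "norm w \<le> B"
  proof -
    have "0 *\<^sub>R w + 0 *\<^sub>R w + 0 *\<^sub>R w + 1 *\<^sub>R w \<in> P"
      using assms by (intro combination) auto
    then show ?thesis using B by auto
  qed
  \<comment> \<open>The sign keeps the combined form nonnegative, and the size carries the point out
    of the ball of radius \<open>B\<close>.\<close>
  define y where "y = (if t\<^sup>2 \<ge> 1 then 1 else - 1) * ((B + norm w + 1) / norm (v - w))"
  have "0 < norm (v - w)" using assms by simp
  have "0 \<le> B + norm w + 1"
    using \<open>norm w \<le> B\<close> norm_ge_zero[of w] by linarith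
  then have y: "\<bar>y\<bar> * norm (v - w) = B + norm w + 1"
    using assms(3) by (auto simp: y_def abs_mult)
  have "y * (t\<^sup>2 - 1) = (B + norm w + 1) / norm (v - w) * \<bar>t\<^sup>2 - 1\<bar>"
    by (auto simp: y_def)
  then have y': "0 \<le> y * (t\<^sup>2 - 1)"
    using \<open>0 \<le> B + norm w + 1\<close> by simp
  have "y *\<^sub>R v + (1 - y) *\<^sub>R w + 0 *\<^sub>R w + 0 *\<^sub>R w \<in> P"
  proof (rule combination)
    fix u
    have "y * (inner (x v) u)\<^sup>2 + (1 - y) * (inner (x w) u)\<^sup>2 + 0 * (inner (x w) u)\<^sup>2 + 0 * (inner (x w) u)\<^sup>2
        = (1 + y * (t\<^sup>2 - 1)) * (inner (x w) u)\<^sup>2"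
      by (simp add: eq power_mult_distrib algebra_simps)
    then show "0 \<le> y * (inner (x v) u)\<^sup>2 + (1 - y) * (inner (x w) u)\<^sup>2 + 0 * (inner (x w) u)\<^sup>2 + 0 * (inner (x w) u)\<^sup>2"
      using y' by (simp del: mult_zero_left)
  qed (use assms in auto)
  then have "norm (w + y *\<^sub>R (v - w)) \<le> B"
    using B by (simp add: algebra_simps)
  moreover have "norm (y *\<^sub>R (v - w)) \<le> norm (w + y *\<^sub>R (v - w)) + norm w"
    using norm_triangle_ineq4[of "w + y *\<^sub>R (v - w)" w] by simp
  ultimately show False
    using y by simp
qed

text \<open>Were \<open>x v\<close> in the span of \<open>x a\<close> and \<open>x b\<close>, a
  small negative weight on \<open>v\<close> would be admissible, giving a point of \<open>P\<close>
  beyond the edge. The endpoints themselves are not parallel.\<close>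

lemma independent:
  assumes e: "ccw_edge E a b" and v: "v \<in> E" "v \<noteq> a" "v \<noteq> b"
    and zero: "r *\<^sub>R x a + s *\<^sub>R x b + t *\<^sub>R x v = 0"
  shows "r = 0 \<and> s = 0 \<and> t = 0"
proof -
  have ab: "a \<in> E" "b \<in> E" "a \<noteq> b" using e by (auto simp: ccw_edge_def)
  have "t = 0"
  proof (rule ccontr)
    assume "t \<noteq> 0"
    define \<alpha> \<beta> where "\<alpha> = - r / t" and "\<beta> = - s / t"
    have "x v - (\<alpha> *\<^sub>R x a + \<beta> *\<^sub>R x b) = (1 / t) *\<^sub>R (r *\<^sub>R x a + s *\<^sub>R x b + t *\<^sub>R x v)"
      using \<open>t \<noteq> 0\<close> by (simp add: \<alpha>_def \<beta>_def scaleR_add_right)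
    then have xv: "x v = \<alpha> *\<^sub>R x a + \<beta> *\<^sub>R x b"
      using zero by simp
    define m where "m = \<alpha>\<^sup>2 + \<beta>\<^sup>2"
    define \<epsilon> where "\<epsilon> = 1 / (2 * (m + 1))"
    have m: "0 \<le> m" by (simp add: m_def)
    then have \<epsilon>: "0 < \<epsilon>" "\<epsilon> * m \<le> 1 / 2" by (auto simp: \<epsilon>_def field_simps)
    have "((1 + \<epsilon>) / 2) *\<^sub>R a + ((1 + \<epsilon>) / 2) *\<^sub>R b + (- \<epsilon>) *\<^sub>R v + 0 *\<^sub>R v \<in> P"
    proof (rule combination)
      fix u
      let ?A = "inner (x a) u" and ?B = "inner (x b) u"
      have "\<epsilon> * (\<alpha> * ?A + \<beta> * ?B)\<^sup>2 \<le> \<epsilon> * (m * (?A\<^sup>2 + ?B\<^sup>2))"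
        using \<epsilon>(1) unfolding m_def by (intro mult_left_mono square_combination_le) auto
      also have "\<dots> = (\<epsilon> * m) * (?A\<^sup>2 + ?B\<^sup>2)" by simp
      also have "\<dots> \<le> (1 + \<epsilon>) / 2 * (?A\<^sup>2 + ?B\<^sup>2)"
        using \<epsilon> by (intro mult_right_mono) auto
      finally show "0 \<le> (1 + \<epsilon>) / 2 * ?A\<^sup>2 + (1 + \<epsilon>) / 2 * ?B\<^sup>2 + (- \<epsilon>) * (inner (x v) u)\<^sup>2 + 0 * (inner (x v) u)\<^sup>2"
        by (simp add: xv inner_add_left algebra_simps)
    qed (use ab v in auto)
    from edge_nonneg[OF e this] have "0 \<le> - \<epsilon> * orient a b v"
      by (subst (asm) orient_combination) auto
    moreover have "0 < orient a b v"
      using ccw_edge_pos[OF e] v by blast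
    ultimately show False
      using \<epsilon>(1) by (simp add: mult_le_0_iff)
  qed
  moreover have "r = 0"
  proof (rule ccontr)
    assume "r \<noteq> 0"
    have "x a - (- s / r) *\<^sub>R x b = (1 / r) *\<^sub>R (r *\<^sub>R x a + s *\<^sub>R x b + t *\<^sub>R x v)"
      using \<open>r \<noteq> 0\<close> \<open>t = 0\<close> by (simp add: scaleR_add_right)
    also have "\<dots> = 0"
      by (simp add: zero)
    finally have "x a = (- s / r) *\<^sub>R x b"
      by (rule eq_iff_diff_eq_0[THEN iffD2])
    then show False using not_parallel ab by blast
  qed
  moreover have "x b \<noteq> 0"
    using not_parallel[of b a 0] ab by auto
  ultimately show ?thesis using zero by auto
qed

lemma coordinates:
  assumes "ccw_edge E a b" "v \<in> E" "v \<noteq> a" "v \<noteq> b"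
  obtains r s t where "y = r *\<^sub>R x a + s *\<^sub>R x b + t *\<^sub>R x v"
  by (rule span_of_independent_triple[of "x a" "x b" "x v" y])
    (use independent[OF assms] in auto)

text \<open>\<open>\<gamma>\<close> is the ratio of the values at \<open>x w\<close> and
  \<open>x v\<close> of the linear form vanishing at \<open>x a\<close> and \<open>x b\<close>.
  Slacks of an edge are thus proportional to squares of one linear form.\<close>

lemma orient_ratio:
  assumes e: "ccw_edge E a b" and v: "v \<in> E" "v \<noteq> a" "v \<noteq> b" and w: "w \<in> E"
    and xw: "x w = \<alpha> *\<^sub>R x a + \<beta> *\<^sub>R x b + \<gamma> *\<^sub>R x v"
  shows "orient a b w = \<gamma>\<^sup>2 * orient a b v"
proof (rule slack_ratio)
  have ab: "a \<in> E" "b \<in> E" using e by (auto simp: ccw_edge_def)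
  show "0 \<le> orient a b v" using ccw_edge_pos[OF e v] by simp
  fix ca cb cv cw :: real
  assume sum: "ca + cb + cv + cw = 1"
    and nn: "\<And>A B V. 0 \<le> ca * A\<^sup>2 + cb * B\<^sup>2 + cv * V\<^sup>2 + cw * (\<alpha> * A + \<beta> * B + \<gamma> * V)\<^sup>2"
  have "ca *\<^sub>R a + cb *\<^sub>R b + cv *\<^sub>R v + cw *\<^sub>R w \<in> P"
    using nn by (intro combination ab v w sum) (simp add: xw inner_add_left)
  from edge_nonneg[OF e this] show "0 \<le> cv * orient a b v + cw * orient a b w"
    by (simp add: orient_combination[OF sum])
qed

text \<open>With \<open>x d = \<alpha> *\<^sub>R x a + \<beta> *\<^sub>R x b + \<gamma> *\<^sub>R x c\<close>, the first three edges force
  \<open>d = \<alpha>\<^sup>2 *\<^sub>R a - \<beta>\<^sup>2 *\<^sub>R b + \<gamma>\<^sup>2 *\<^sub>R c\<close>. A linear form vanishing at \<open>x d\<close> and \<open>x e\<close> and its square,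
  which is the slack of the fourth edge, then give \<open>A + B + C = 0\<close> and \<open>A\<^sup>2 - B\<^sup>2 + C\<^sup>2 = 0\<close> for
  nonzero \<open>A\<close> and \<open>C\<close>.\<close>

lemma no_path_5:
  assumes ab: "ccw_edge E a b" and bc: "ccw_edge E b c" and cd: "ccw_edge E c d" and de: "ccw_edge E d e"
    and dist: "distinct [a, b, c, d, e]"
  shows False
proof -
  have mem: "a \<in> E" "b \<in> E" "c \<in> E" "d \<in> E" "e \<in> E"
    using ab bc cd de by (simp_all add: ccw_edge_def)
  have ne: "a \<noteq> b" "a \<noteq> c" "a \<noteq> d" "a \<noteq> e" "b \<noteq> c" "b \<noteq> d" "b \<noteq> e" "c \<noteq> d" "c \<noteq> e" "d \<noteq> e"
    using dist by auto
  note ne' = ne ne[symmetric]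
  obtain \<alpha> \<beta> \<gamma> where xd: "x d = \<alpha> *\<^sub>R x a + \<beta> *\<^sub>R x b + \<gamma> *\<^sub>R x c"
    using coordinates[OF ab mem(3) ne'(12) ne'(15)] by blast
  have abd: "orient a b d = \<gamma>\<^sup>2 * orient a b c"
    by (rule orient_ratio[OF ab _ _ _ _ xd]) (use mem ne' in blast)+
  have "x d = \<beta> *\<^sub>R x b + \<gamma> *\<^sub>R x c + \<alpha> *\<^sub>R x a"
    using xd by (simp add: algebra_simps)
  from orient_ratio[OF bc mem(1) _ _ mem(4) this] have bcd: "orient b c d = \<alpha>\<^sup>2 * orient b c a"
    using ne' by blast
  have pos: "0 < orient a b c" "0 < orient a b d" "0 < orient b c d" "0 < orient d e a" "0 < orient d e c"
    using ccw_edge_pos[OF ab mem(3)] ccw_edge_pos[OF ab mem(4)] ccw_edge_pos[OF bc mem(4)]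
      ccw_edge_pos[OF de mem(1)] ccw_edge_pos[OF de mem(3)] ne' by blast+
  have nz: "\<alpha> \<noteq> 0" "\<gamma> \<noteq> 0"
    using abd bcd pos by auto
  have "(1 / \<alpha>) *\<^sub>R x d = (1 / \<alpha>) *\<^sub>R (\<alpha> *\<^sub>R x a + \<beta> *\<^sub>R x b + \<gamma> *\<^sub>R x c)"
    by (simp add: xd)
  \<comment> \<open>Solving for \<open>x a\<close> brings in the third edge, whose slacks at
    \<open>a\<close> and \<open>b\<close> then yield the coefficient of \<open>b\<close>.\<close>
  then have "x a = (- \<gamma> / \<alpha>) *\<^sub>R x c + (1 / \<alpha>) *\<^sub>R x d + (- \<beta> / \<alpha>) *\<^sub>R x b"
    using nz by (simp add: scaleR_add_right)
  from orient_ratio[OF cd mem(2) _ _ mem(1) this] have "orient c d a = (\<beta> / \<alpha>)\<^sup>2 * orient c d b"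
    using ne' by simp
  then have "orient c d a = \<beta>\<^sup>2 * orient a b c"
    using bcd nz orient_rotate[of c d b] orient_rotate[of b c d] orient_rotate[of b c a] orient_rotate[of c a b]
    by (simp add: power_divide)
  then have cad: "orient c a d = - (\<beta>\<^sup>2 * orient a b c)"
    using orient_swap[of c a d] orient_rotate[of c d a] orient_rotate[of a c d] by simp
  \<comment> \<open>\<open>\<mu>\<close> and, below, \<open>\<nu>\<close> are the values at
    \<open>x b\<close> and \<open>x c\<close> of the linear form that vanishes at \<open>x d\<close>
    and \<open>x e\<close> and is 1 at \<open>x a\<close>.\<close>
  obtain r s \<mu> where xb: "x b = r *\<^sub>R x d + s *\<^sub>R x e + \<mu> *\<^sub>R x a"
    using coordinates[OF de mem(1) ne(3,4)] by blast
  obtain r' s' \<nu> where xc: "x c = r' *\<^sub>R x d + s' *\<^sub>R x e + \<nu> *\<^sub>R x a"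
    using coordinates[OF de mem(1) ne(3,4)] by blast
  have deb: "orient d e b = \<mu>\<^sup>2 * orient d e a" and dec: "orient d e c = \<nu>\<^sup>2 * orient d e a"
    using orient_ratio[OF de mem(1) ne(3,4) mem(2) xb] orient_ratio[OF de mem(1) ne(3,4) mem(3) xc] by auto
  have "(\<beta> * r + \<gamma> * r' - 1) *\<^sub>R x d + (\<beta> * s + \<gamma> * s') *\<^sub>R x e + (\<alpha> + \<beta> * \<mu> + \<gamma> * \<nu>) *\<^sub>R x a
      = \<alpha> *\<^sub>R x a + \<beta> *\<^sub>R x b + \<gamma> *\<^sub>R x c - x d"
    unfolding xb xc by (simp add: algebra_simps)
  also have "\<dots> = 0" using xd by simp
  \<comment> \<open>The coordinate along \<open>x a\<close> of the relation for
    \<open>x d\<close>.\<close>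
  finally have lin: "\<alpha> + \<beta> * \<mu> + \<gamma> * \<nu> = 0"
    using independent[OF de mem(1) ne(3,4)] by blast
  have "orient b c d * orient d e a + orient c a d * orient d e b + orient a b d * orient d e c = 0"
    by (rule orient_pluecker)
  then have "(\<alpha>\<^sup>2 - \<beta>\<^sup>2 * \<mu>\<^sup>2 + \<gamma>\<^sup>2 * \<nu>\<^sup>2) * (orient a b c * orient d e a) = 0"
    unfolding abd bcd cad deb dec orient_rotate[of b c a] by (simp add: algebra_simps)
  then have "\<alpha>\<^sup>2 - (\<beta> * \<mu>)\<^sup>2 + (\<gamma> * \<nu>)\<^sup>2 = 0"
    using pos by (simp add: power_mult_distrib)
  \<comment> \<open>After this substitution the squares cancel and only a multiple of
    \<open>\<alpha> * (\<gamma> * \<nu>)\<close> survives.\<close>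
  moreover have "\<beta> * \<mu> = - (\<alpha> + \<gamma> * \<nu>)" using lin by simp
  ultimately have "\<alpha> * (\<gamma> * \<nu>) = 0"
    by (simp add: power2_eq_square algebra_simps)
  moreover have "\<nu> \<noteq> 0" using dec pos by auto
  ultimately show False using nz by simp
qed

end

section \<open>The psd rank of a polygon\<close>

lemma orient_nonneg_hull:
  assumes "ccw_edge E v w" "p \<in> convex hull E"
  shows "0 \<le> orient v w p"
proof -
  have "convex {p. 0 \<le> orient v w p}"
  proof (rule convexI)
    fix p q and s t :: real
    assume "p \<in> {p. 0 \<le> orient v w p}" "q \<in> {p. 0 \<le> orient v w p}" "0 \<le> s" "0 \<le> t" "s + t = 1"
    then show "s *\<^sub>R p + t *\<^sub>R q \<in> {p. 0 \<le> orient v w p}"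
      using orient_combination[of s t 0 0 v w p q 0 0] by simp
  qed
  moreover have "E \<subseteq> {p. 0 \<le> orient v w p}"
  proof
    fix u assume "u \<in> E"
    then show "u \<in> {p. 0 \<le> orient v w p}"
      using ccw_edge_pos[OF assms(1), of u] by (cases "u = v \<or> u = w") auto
  qed
  ultimately show ?thesis
    using assms(2) hull_minimal by blast
qed

lemma polygon_extreme_points:
  fixes P :: "(real ^ 2) set"
  assumes "polytope P" "aff_dim P = 2"
  defines "E \<equiv> {v. v extreme_point_of P}"
  shows "finite E" "P = convex hull E" "convex_position E" "3 \<le> card E"
proof -
  show fin: "finite E"
    unfolding E_def using assms by (simp add: finite_polyhedron_extreme_points polytope_imp_polyhedron)
  show hull: "P = convex hull E"
    unfolding E_def using assms(1) by (metis Krein_Milman_polytope polytope_def)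
  show "convex_position E"
    unfolding convex_position_def
  proof
    fix v assume v: "v \<in> E"
    show "v \<notin> convex hull (E - {v})"
    proof
      assume "v \<in> convex hull (E - {v})"
      \<comment> \<open>A vertex in the hull of the others is redundant, so the others would
        generate \<open>P\<close> and have \<open>v\<close> among them.\<close>
      then have "convex hull (E - {v}) = convex hull (insert v (E - {v}))"
        by (rule hull_redundant[symmetric])
      also have "insert v (E - {v}) = E"
        using v by blast
      also note hull[symmetric]
      finally have "v extreme_point_of convex hull (E - {v})"
        using v by (simp add: E_def)
      then have "v \<in> E - {v}"
        by (rule extreme_point_of_convex_hull)
      then show False by simp
    qed
  qed
  show "3 \<le> card E"
    using aff_dim_le_card[OF fin] assms(2) hull by (simp add: aff_dim_convex_hull)
qed

text \<open>Padding to size 3 treats all \<open>k\<close> at once. For smaller \<open>k\<close> a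
  common kernel vector would be orthogonal to every \<open>x v\<close>, but three of these already
  span the space.\<close>

lemma polygon_psd_lift_bounds:
  fixes P :: "(real ^ 2) set"
  assumes P: "polytope P" "aff_dim P = 2" and k: "k \<le> 3" and lift: "has_psd_lift k P"
  shows "k = 3" "card {v. v extreme_point_of P} \<le> 4"
proof -
  define E where "E = {v. v extreme_point_of P}"
  note E = polygon_extreme_points[OF P, folded E_def]
  have EP: "v \<in> P" if "v \<in> E" for v
    using that by (simp add: E_def extreme_point_of_def)
  have "k \<le> CARD(3)" using k by simp
  then obtain G :: "((real ^ 3 ^ 3) \<times> (real ^ 2)) set" where
    G: "affine G" "\<And>X p. (X, p) \<in> G \<Longrightarrow> Finite_Cartesian_Product.transpose X = X"
      "P = {p. \<exists>X. (X, p) \<in> G \<and> psd_form X}"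
      "k < CARD(3) \<Longrightarrow> \<exists>e. e \<noteq> 0 \<and> (\<forall>X p. (X, p) \<in> G \<longrightarrow> X *v e = 0)"
    by (rule psd_lift_affine[OF lift]) (rule that; blast)
  have edge: "\<exists>w u. ccw_edge E v w \<and> u \<in> E \<and> u \<noteq> v \<and> u \<noteq> w" if v: "v \<in> E" for v
  proof -
    have "E \<noteq> {v}" using E(4) by auto
    then obtain w where w: "ccw_edge E v w"
      using ccw_edge_exists[OF E(1,3) v] by blast
    have "\<not> E \<subseteq> {v, w}"
    proof
      assume "E \<subseteq> {v, w}"
      then have "card E \<le> card {v, w}" by (intro card_mono) auto
      then show False using E(4) card_length[of "[v, w]"] by simp
    qed
    then show ?thesis using w by auto
  qed
  have "\<exists>x. (outer x, v) \<in> G" if v: "v \<in> E" for v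
  proof -
    obtain w u where wu: "ccw_edge E v w" "u \<in> E" "u \<noteq> v" "u \<noteq> w"
      using edge[OF v] by blast
    have w: "w \<in> E" "w \<noteq> v" using wu by (auto simp: ccw_edge_def)
    have nonneg: "0 \<le> orient v w p" if "p \<in> P" for p
      using orient_nonneg_hull[OF wu(1)] E(2) that by simp
    show ?thesis
    proof (rule extreme_fibre_rank_one[OF G(1) _ G(3)])
      show "Finite_Cartesian_Product.transpose X = X" if "(X, p) \<in> G" for X p
        using that by (rule G(2))
      show "v extreme_point_of P" using v by (simp add: E_def)
      show "w \<in> P" "u \<in> P" by (intro EP w wu)+
      show "w \<noteq> v" by (rule w(2))
      show "0 < orient v w u" by (rule ccw_edge_pos[OF wu])
      show "0 \<le> orient v w p" if "p \<in> P" for p using that by (rule nonneg)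
      show "CARD(3) \<le> 3" by simp
    qed (rule exI)
  qed
  then obtain x where x: "\<And>v. v \<in> E \<Longrightarrow> (outer (x v), v) \<in> G"
    by metis
  interpret psd_polygon P E x
  proof
    show "bounded P" using P(1) by (rule polytope_imp_bounded)
    show "0 \<le> orient v w p" if "ccw_edge E v w" "p \<in> P" for v w p
      using orient_nonneg_hull[OF that(1)] E(2) that(2) by simp
  next
    fix p q r s and a b c d :: real
    assume mem: "p \<in> E" "q \<in> E" "r \<in> E" "s \<in> E" and sum: "a + b + c + d = 1"
      and nn: "\<And>u. 0 \<le> a * (inner (x p) u)\<^sup>2 + b * (inner (x q) u)\<^sup>2 + c * (inner (x r) u)\<^sup>2 + d * (inner (x s) u)\<^sup>2"
    let ?X = "a *\<^sub>R outer (x p) + b *\<^sub>R outer (x q) + c *\<^sub>R outer (x r) + d *\<^sub>R outer (x s)"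
    have "a *\<^sub>R (outer (x p), p) + b *\<^sub>R (outer (x q), q) + c *\<^sub>R (outer (x r), r) + d *\<^sub>R (outer (x s), s) \<in> G"
      by (intro affine_combination_4 G(1) x mem sum)
    then have "(?X, a *\<^sub>R p + b *\<^sub>R q + c *\<^sub>R r + d *\<^sub>R s) \<in> G" by simp
    moreover have "inner u (?X *v u)
        = a * (inner (x p) u)\<^sup>2 + b * (inner (x q) u)\<^sup>2 + c * (inner (x r) u)\<^sup>2 + d * (inner (x s) u)\<^sup>2" for u
      unfolding matrix_vector_mult_add_rdistrib scaleR_matrix_vector_assoc[symmetric] outer_mult
      by (simp add: inner_add_right power2_eq_square inner_commute)
    then have "psd_form ?X"
      using nn by (simp add: psd_form_def)
    ultimately show "a *\<^sub>R p + b *\<^sub>R q + c *\<^sub>R r + d *\<^sub>R s \<in> P"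
      using G(3) by blast
  qed
  show "card {v. v extreme_point_of P} \<le> 4"
  proof (rule ccontr)
    assume "\<not> ?thesis"
    then have "5 \<le> card E" by (simp add: E_def)
    then obtain a b c d e where "ccw_edge E a b" "ccw_edge E b c" "ccw_edge E c d" "ccw_edge E d e"
      "distinct [a, b, c, d, e]"
      by (rule ccw_path_5[OF E(1,3)])
    then show False by (rule no_path_5)
  qed
  show "k = 3"
  proof (rule ccontr)
    assume "k \<noteq> 3"
    then have "k < CARD(3)" using k by simp
    then obtain e where e: "e \<noteq> 0" "\<And>X p. (X, p) \<in> G \<Longrightarrow> X *v e = 0"
      using G(4) by blast
    have orth: "inner (x v) e = 0" if "v \<in> E" for v
      using e(2)[OF x[OF that]] by (auto simp: outer_mult)
    obtain v where v: "v \<in> E" using E(4) by fastforce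
    then obtain w u where wu: "ccw_edge E v w" "u \<in> E" "u \<noteq> v" "u \<noteq> w"
      using edge by blast
    then have w: "w \<in> E" by (simp add: ccw_edge_def)
    obtain r s t where "e = r *\<^sub>R x v + s *\<^sub>R x w + t *\<^sub>R x u"
      using coordinates[OF wu] by blast
    then have "inner e e = inner (r *\<^sub>R x v + s *\<^sub>R x w + t *\<^sub>R x u) e"
      by (rule arg_cong[of _ _ "\<lambda>y. inner y e"])
    then show False
      using e(1) orth v w wu(2) by (simp add: inner_add_left)
  qed
qed

text \<open>Four vertices are put in cyclic order first, so that the signs of the barycentric
  coordinates of the last one are known.\<close>

lemma polygon_has_psd_lift_3:
  fixes P :: "(real ^ 2) set"
  assumes P: "polytope P" "aff_dim P = 2" and card: "card {v. v extreme_point_of P} \<le> 4"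
  shows "has_psd_lift 3 P"
proof -
  define E where "E = {v. v extreme_point_of P}"
  note E = polygon_extreme_points[OF P, folded E_def]
  consider "card E = 3" | "card E = 4"
    using E(4) card unfolding E_def by linarith
  then show ?thesis
  proof cases
    case 1
    then show ?thesis
      using polytope_has_psd_lift[OF P(1)] by (simp add: E_def)
  next
    case 2
    then have "4 \<le> card E" by simp
    then obtain a b c d where path: "ccw_edge E a b" "ccw_edge E b c" "ccw_edge E c d" "distinct [a, b, c, d]"
      by (rule ccw_path_4[OF E(1,3)])
    have "{a, b, c, d} \<subseteq> E" using path by (auto simp: ccw_edge_def)
    moreover have "card {a, b, c, d} = 4" using path(4) by simp
    ultimately have "{a, b, c, d} = E"
      using card_subset_eq[OF E(1)] 2 by metis
    then have ext: "{v. v extreme_point_of P} = {a, b, c, d}"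
      by (simp only: E_def)
    have mem: "a \<in> E" "b \<in> E" "c \<in> E" "d \<in> E" using \<open>{a, b, c, d} \<subseteq> E\<close> by auto
    let ?D = "orient a b c"
    have pos: "0 < ?D" "0 < orient b c d" "0 < orient a b d" "0 < orient c d a"
      using path(4) mem ccw_edge_pos[OF path(1), of c] ccw_edge_pos[OF path(1), of d]
        ccw_edge_pos[OF path(2), of d] ccw_edge_pos[OF path(3), of a] by auto
    have cad: "orient c a d = - orient c d a"
      using orient_swap[of c a d] orient_rotate[of c d a] by simp
    show ?thesis
    proof (rule quadrilateral_has_psd_lift[OF P(1) ext])
      \<comment> \<open>The vertex \<open>b\<close> is opposite to \<open>d\<close>, hence the only
        one of the three with a negative coordinate.\<close>
      show "0 < orient b c d / ?D" "0 < orient c d a / ?D" "0 < orient a b d / ?D"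
        using pos by auto
      show "orient b c d / ?D - orient c d a / ?D + orient a b d / ?D = 1"
        using pos(1) orient_sum[of b c d a] cad by (simp add: add_divide_distrib[symmetric] diff_divide_distrib[symmetric])
      have "d = (1 / ?D) *\<^sub>R (?D *\<^sub>R d)"
        using pos(1) by simp
      also have "\<dots> = (orient b c d / ?D) *\<^sub>R a - (orient c d a / ?D) *\<^sub>R b + (orient a b d / ?D) *\<^sub>R c"
        by (subst orient_barycentric[of a b c d]) (simp add: cad scaleR_add_right scaleR_diff_right)
      finally show "d = \<dots>" .
    qed
  qed
qed

theorem theorem4p7:
  fixes P :: "(real ^ 2) set"
  assumes "polytope P" and "aff_dim P = 2"
  shows "psd_rank P = 3 \<longleftrightarrow> card {v. v extreme_point_of P} \<le> 4"
proof
  assume rank: "psd_rank P = 3"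
  \<comment> \<open>\<^const>\<open>psd_rank\<close> is meaningful only because some lift exists.\<close>
  have "0 < card {v. v extreme_point_of P}"
    using polygon_extreme_points(4)[OF assms] by simp
  then have "\<exists>k. k > 0 \<and> has_psd_lift k P"
    using polytope_has_psd_lift[OF assms(1)] by blast
  from LeastI_ex[OF this] have "has_psd_lift (psd_rank P) P"
    unfolding psd_rank_def by (rule conjunct2)
  then show "card {v. v extreme_point_of P} \<le> 4"
    using polygon_psd_lift_bounds(2)[OF assms, of 3] rank by simp
next
  assume "card {v. v extreme_point_of P} \<le> 4"
  then have "has_psd_lift 3 P"
    by (rule polygon_has_psd_lift_3[OF assms])
  moreover have "3 \<le> k" if "has_psd_lift k P" for k
    using polygon_psd_lift_bounds(1)[OF assms _ that] by (cases "k \<le> 3") auto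
  ultimately show "psd_rank P = 3"
    unfolding psd_rank_def by (intro Least_equality) auto
qed

end
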